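(* Let $N\in\mathbb{N}$ be a positive multiple of $4$, let $\mu_0,\mu_1\in\mathbb{R}$, and let $\mathbf{b}=(b_1,b_2,\dots,b_{N/2})\in\mathbb{R}^{N/2}$ be a nontrivial (i.e. nonzero) solution of the system of equations $$\psi^{(i,j,k,l)}(\mathbf{b})=0\qquad\text{for all }(i,j,k,l)\in S_1\cup S_2 .$$ Then the lattice defined by the Hamiltonian $$H=\sum_{n=1}^{N}\frac12 p_n^2+\sum_{n=1}^{N}\Big[\frac{\mu_0}{2}q_n^2+\frac{\mu_1}{2}(q_{n+1}-q_n)^2\Big]+\frac14\sum_{n=1}^{N}\sum_{r=1}^{N/2}b_r(q_{n+r}-q_n)^4$$ (with indices of $q$ read periodically modulo $N$) is a symmetric lattice, and this Hamiltonian is given explicitly by $$H=\frac12\sum_{n=1}^{N}p_n^2+\frac12\sum_{n=1}^{N}\big[\mu_0q_n^2+\mu_1(q_{n+1}-q_n)^2\big]+\frac14\sum_{n=1}^{N}\sum_{r=1}^{N/2-1}\frac{b_1\sin^2\frac{\pi}{N}}{\sin^2\frac{r\pi}{N}}(q_{n+r}-q_n)^4+\frac18\sum_{n=1}^{N}b_1\sin^2\Big(\frac{\pi}{N}\Big)(q_{n+N/2}-q_n)^4,$$ where $b_1$ is an arbitrary nonzero constant (that is, the first component $b_1$ of $\mathbf b$ is nonzero, and it may take any nonzero real value).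
   Context: **The equations.** Write $N_h=N/2-1$, $c_\alpha=\cos(\alpha\pi/N)$, $s_\alpha=\sin(\alpha\pi/N)$. For $(i,j,k,l)\in\mathbb{Z}^4$ and $\mathbf{b}=(b_1,\dots,b_{N/2})\in\mathbb{R}^{N/2}$ put $$\psi^{(i,j,k,l)}(\mathbf{b})=-\sum_{q=1}^{N/2}(-1)^q b_q f_q^{(i,j,k,l)},\qquad f_q^{(i,j,k,l)}=\begin{cases}c_{iq}c_{jq}c_{kq}c_{lq}&q\text{ odd},\\ s_{iq}s_{jq}s_{kq}s_{lq}&q\text{ even}.\end{cases}$$ The index sets are $S_1=\{(0,n+1,N/2-n,N/2-1)\mid 1\le n\le N/4-1\}$ and $S_2=\{(2-m,m,N/2-1,N/2-1)\mid m=1\text{ or }3\le m\le N/4+1\}$ ($n,m$ integers). **Symmetric lattice.** Consider a Hamiltonian $H=\frac12\sum_{n=1}^N p_n^2+\Phi(q_1,\dots,q_N)$ on $\mathbb{R}^{2N}$, with $N$ even, periodic boundary conditions $q_{n+N}=q_n$, $p_{n+N}=p_n$, and $\Phi$ a polynomial. The equations of motion are $\dot q_n=\partial H/\partial p_n$, $\dot p_n=-\partial H/\partial q_n$. Complex normal mode coordinates $U_m\in\mathbb{C}$, $m=-N/2+1,\dots,N/2$, are defined by $$q_n=\frac{(-1)^n}{\sqrt N}\sum_{m=-N/2+1}^{N/2}U_m\exp\Big[-i\frac{2\pi n}{N}m\Big],\quad n=1,\dots,N.$$ Let $\mathbf{U}=(U_{-N_h},\dots,U_{N_h})\in\mathbb{C}^{N-1}$,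 and write $\Phi(\mathbf{U},U_{N/2})$ for the potential expressed (as a polynomial) in these coordinates. For $\lambda\in\mathbb{R}$ let $\mathcal{T}_\lambda:\mathbb{C}^{N-1}\to\mathbb{C}^{N-1}$, $U_m\mapsto U_m\exp(-im\lambda)$, $m=-N_h,\dots,N_h$. Decompose $\Phi(\mathbf{U},0)=\Phi_{\mathrm s}(\mathbf{U})+\Phi_{\mathrm a}(\mathbf{U})$, where $\Phi_{\mathrm s}$ is the part (sum of monomials) satisfying $\Phi_{\mathrm s}(\mathcal{T}_\lambda\mathbf{U})=\Phi_{\mathrm s}(\mathbf{U})$ for all $\lambda\in\mathbb{R}$, $\mathbf{U}\in\mathbb{C}^{N-1}$, and $\Phi_{\mathrm a}$ is the remaining, non-invariant part. Put $\Psi(\mathbf{U},U_{N/2})=\Phi(\mathbf{U},U_{N/2})-\Phi_{\mathrm s}(\mathbf{U})$, so $\Psi(\mathbf{U},0)=\Phi_{\mathrm a}(\mathbf{U})$. Let $\mathcal{I}=\{(\mathbf{q},\mathbf{p})\in\mathbb{R}^{2N}\mid\sum_{n=1}^N q_n=\sum_{n=1}^N p_n=0\}$ (equivalently $U_{N/2}=\dot U_{N/2}=0$). The lattice is called a *symmetric lattice* if $\mathcal{I}$ is an invariant subspace of the dynamics and $\Psi(\mathbf{U},0)=0$ identically (equivalently, $\Phi(\mathcal{T}_\lambda\mathbf{U},0)=\Phi(\mathbf{U},0)$ for all $\lambda\in\mathbb{R}$ and all $\mathbf{U}\in\mathbb{C}^{N-1}$). *)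

theory Defs
  imports "HOL-Analysis.Analysis" "HOL-Library.Poly_Mapping"
begin

section \<open>Multivariate polynomials\<close>

text \<open>
  Polynomials in variables of type \<open>'v\<close> are finitely supported maps from exponent vectors to
  coefficients; the ring structure is the convolution product of \<^theory>\<open>HOL-Library.Poly_Mapping\<close>.
\<close>

type_synonym ('v, 'a) mpoly = "('v \<Rightarrow>\<^sub>0 nat) \<Rightarrow>\<^sub>0 'a"

definition mconst :: "'a::zero \<Rightarrow> ('v, 'a) mpoly" where
  "mconst c = Poly_Mapping.single 0 c"

definition mvar :: "'v \<Rightarrow> ('v, 'a::zero_neq_one) mpoly" where
  "mvar v = Poly_Mapping.single (Poly_Mapping.single v 1) 1"

definition mvars :: "('v, 'a::zero) mpoly \<Rightarrow> 'v set" where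
  "mvars P = (\<Union>e\<in>Poly_Mapping.keys P. Poly_Mapping.keys e)"

definition monom_eval :: "('v \<Rightarrow> 'b::comm_semiring_1) \<Rightarrow> ('v \<Rightarrow>\<^sub>0 nat) \<Rightarrow> 'b" where
  "monom_eval x e = (\<Prod>v\<in>Poly_Mapping.keys e. x v ^ Poly_Mapping.lookup e v)"

text \<open>
  Evaluation along a map \<open>h\<close> of the coefficients. With \<open>h = id\<close> this is ordinary evaluation; if
  \<open>'b\<close> is itself a polynomial ring and \<open>h\<close> embeds the scalars, it is substitution.
\<close>

definition meval :: "('a::zero \<Rightarrow> 'b::comm_semiring_1) \<Rightarrow> ('v \<Rightarrow> 'b) \<Rightarrow> ('v, 'a) mpoly \<Rightarrow> 'b" where
  "meval h x P = (\<Sum>e\<in>Poly_Mapping.keys P. h (Poly_Mapping.lookup P e) * monom_eval x e)"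


section \<open>Hamiltonian lattices\<close>

text \<open>
  A point of phase space is a pair of functions of which only the values at \<open>1, \<dots>, N\<close> matter;
  a Hamiltonian is a function of such a pair.
\<close>

type_synonym hamiltonian = "(nat \<Rightarrow> real) \<Rightarrow> (nat \<Rightarrow> real) \<Rightarrow> real"

definition periodic :: "nat \<Rightarrow> (nat \<Rightarrow> real) \<Rightarrow> nat \<Rightarrow> real" where
  "periodic N q n = q ((n - 1) mod N + 1)"

definition natural_hamiltonian :: "nat \<Rightarrow> (nat, real) mpoly \<Rightarrow> hamiltonian" where
  "natural_hamiltonian N \<Phi> q p = 1/2 * (\<Sum>n=1..N. (p n)\<^sup>2) + meval id q \<Phi>"

text \<open>
  Solutions of Hamilton's equations on a time interval \<open>T\<close>. The term \<open>deriv \<dots>\<close> is the partial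
  derivative of \<open>H\<close> in the coordinate that is being updated.
\<close>

definition hamilton_solution ::
  "nat \<Rightarrow> hamiltonian \<Rightarrow> real set \<Rightarrow> (real \<Rightarrow> nat \<Rightarrow> real) \<Rightarrow> (real \<Rightarrow> nat \<Rightarrow> real) \<Rightarrow> bool" where
  "hamilton_solution N H T q p \<longleftrightarrow> (\<forall>t\<in>T. \<forall>n\<in>{1..N}.
     ((\<lambda>s. q s n) has_real_derivative
        deriv (\<lambda>x. H (q t) ((p t)(n := x))) (p t n)) (at t within T) \<and>
     ((\<lambda>s. p s n) has_real_derivative
        - deriv (\<lambda>x. H ((q t)(n := x)) (p t)) (q t n)) (at t within T))"

definition zero_mean :: "nat \<Rightarrow> (nat \<Rightarrow> real) \<Rightarrow> (nat \<Rightarrow> real) \<Rightarrow> bool" where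
  "zero_mean N q p \<longleftrightarrow> (\<Sum>n=1..N. q n) = 0 \<and> (\<Sum>n=1..N. p n) = 0"

definition zero_mean_invariant :: "nat \<Rightarrow> hamiltonian \<Rightarrow> bool" where
  "zero_mean_invariant N H \<longleftrightarrow>
     (\<forall>T q p. is_interval T \<longrightarrow> hamilton_solution N H T q p \<longrightarrow>
        (\<forall>s\<in>T. \<forall>t\<in>T. zero_mean N (q s) (p s) \<longrightarrow> zero_mean N (q t) (p t)))"


section \<open>Normal modes and symmetric lattices\<close>

text \<open>The coordinate \<open>q n\<close> as a linear form in the mode variables \<open>U m\<close>, \<open>-N/2+1 \<le> m \<le> N/2\<close>.\<close>

definition mode_expansion :: "nat \<Rightarrow> nat \<Rightarrow> (int, complex) mpoly" where
  "mode_expansion N n =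
     mconst ((-1) ^ n / of_real (sqrt (real N))) *
     (\<Sum>m\<in>{- int (N div 2) + 1 .. int (N div 2)}.
        mconst (exp (- \<i> * of_real (2 * pi * real n / real N * real_of_int m))) * mvar m)"

definition mode_potential :: "nat \<Rightarrow> (nat, real) mpoly \<Rightarrow> (int, complex) mpoly" where
  "mode_potential N \<Phi> = meval (\<lambda>c. mconst (of_real c)) (mode_expansion N) \<Phi>"

text \<open>The polynomial \<open>\<Phi>(U, 0)\<close>, which only involves \<open>U m\<close> for \<open>\<bar>m\<bar> \<le> N/2 - 1\<close>.\<close>

definition reduced_potential :: "nat \<Rightarrow> (nat, real) mpoly \<Rightarrow> (int, complex) mpoly" where
  "reduced_potential N \<Phi> =
     meval mconst (\<lambda>m. if m = int (N div 2) then 0 else mvar m) (mode_potential N \<Phi>)"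

definition mode_rotation :: "real \<Rightarrow> (int \<Rightarrow> complex) \<Rightarrow> int \<Rightarrow> complex" where
  "mode_rotation \<theta> U m = U m * exp (- \<i> * of_int m * of_real \<theta>)"

definition invariant_monom :: "(int \<Rightarrow>\<^sub>0 nat) \<Rightarrow> bool" where
  "invariant_monom e \<longleftrightarrow>
     (\<forall>(\<theta> :: real) (U :: int \<Rightarrow> complex). monom_eval (mode_rotation \<theta> U) e = monom_eval U e)"

definition symmetric_part :: "nat \<Rightarrow> (nat, real) mpoly \<Rightarrow> (int, complex) mpoly" where
  "symmetric_part N \<Phi> =
     (\<Sum>e | e \<in> Poly_Mapping.keys (reduced_potential N \<Phi>) \<and> invariant_monom e.
        Poly_Mapping.single e (Poly_Mapping.lookup (reduced_potential N \<Phi>) e))"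

text \<open>\<open>\<Psi>(U, w) = \<Phi>(U, w) - \<Phi>\<^sub>s(U)\<close>, with \<open>w\<close> the value of the mode of index \<open>N/2\<close>.\<close>

definition asymmetric_potential ::
  "nat \<Rightarrow> (nat, real) mpoly \<Rightarrow> (int \<Rightarrow> complex) \<Rightarrow> complex \<Rightarrow> complex" where
  "asymmetric_potential N \<Phi> U w =
     meval id (U(int (N div 2) := w)) (mode_potential N \<Phi>) - meval id U (symmetric_part N \<Phi>)"

text \<open>
  The potential is unique if it exists, since a real polynomial is determined by its values.
\<close>

definition symmetric_lattice :: "nat \<Rightarrow> hamiltonian \<Rightarrow> bool" where
  "symmetric_lattice N H \<longleftrightarrow> N > 0 \<and> even N \<and>
     (\<exists>\<Phi>. mvars \<Phi> \<subseteq> {1..N} \<and> H = natural_hamiltonian N \<Phi> \<and>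
        zero_mean_invariant N H \<and> (\<forall>U. asymmetric_potential N \<Phi> U 0 = 0))"


section \<open>The quartic lattice and its equations\<close>

definition quartic_hamiltonian :: "nat \<Rightarrow> real \<Rightarrow> real \<Rightarrow> (nat \<Rightarrow> real) \<Rightarrow> hamiltonian" where
  "quartic_hamiltonian N \<mu>0 \<mu>1 b q p =
     (\<Sum>n=1..N. 1/2 * (p n)\<^sup>2) +
     (\<Sum>n=1..N. \<mu>0/2 * (q n)\<^sup>2 + \<mu>1/2 * (periodic N q (n+1) - q n)\<^sup>2) +
     1/4 * (\<Sum>n=1..N. \<Sum>r=1..N div 2. b r * (periodic N q (n+r) - q n) ^ 4)"

definition cN :: "nat \<Rightarrow> int \<Rightarrow> real" where
  "cN N \<alpha> = cos (real_of_int \<alpha> * pi / real N)"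

definition sN :: "nat \<Rightarrow> int \<Rightarrow> real" where
  "sN N \<alpha> = sin (real_of_int \<alpha> * pi / real N)"

definition fq :: "nat \<Rightarrow> nat \<Rightarrow> int \<times> int \<times> int \<times> int \<Rightarrow> real" where
  "fq N q = (\<lambda>(i, j, k, l).
     if odd q
     then cN N (i * int q) * cN N (j * int q) * cN N (k * int q) * cN N (l * int q)
     else sN N (i * int q) * sN N (j * int q) * sN N (k * int q) * sN N (l * int q))"

definition \<psi> :: "nat \<Rightarrow> int \<times> int \<times> int \<times> int \<Rightarrow> (nat \<Rightarrow> real) \<Rightarrow> real" where
  "\<psi> N ijkl b = - (\<Sum>q=1..N div 2. (-1) ^ q * b q * fq N q ijkl)"

definition S1 :: "nat \<Rightarrow> (int \<times> int \<times> int \<times> int) set" where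
  "S1 N = {(0, n + 1, int N div 2 - n, int N div 2 - 1) | n. 1 \<le> n \<and> n \<le> int N div 4 - 1}"

definition S2 :: "nat \<Rightarrow> (int \<times> int \<times> int \<times> int) set" where
  "S2 N = {(2 - m, m, int N div 2 - 1, int N div 2 - 1) | m.
             m = 1 \<or> (3 \<le> m \<and> m \<le> int N div 4 + 1)}"

text \<open>Only the entries \<open>b 1, \<dots>, b (N/2)\<close> are components of the vector.\<close>

definition nontrivial_solution :: "nat \<Rightarrow> (nat \<Rightarrow> real) \<Rightarrow> bool" where
  "nontrivial_solution N b \<longleftrightarrow>
     (\<exists>r\<in>{1..N div 2}. b r \<noteq> 0) \<and> (\<forall>ijkl\<in>S1 N \<union> S2 N. \<psi> N ijkl b = 0)"

end

theory Submission
  imports Defs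
begin

text \<open>
  Put \<open>\<omega> = exp (2\<pi>i/N)\<close> and replace each mode index \<open>m\<close> by \<open>a = N/2 - m\<close>. Then
  \<open>(-1)\<^sup>q f\<^sub>q = (1/16) \<Prod>\<^sub>s (\<omega>\<^bsup>q a\<^sub>s\<^esup> - 1)\<close> whenever the mode indices sum to \<open>N\<close>, i.e. whenever
  \<open>\<Sum>\<^sub>s a\<^sub>s = N\<close>. Extend \<open>b\<close> symmetrically to \<open>\<int>/N\<close> and multiply by \<open>\<bar>1 - \<omega>\<^sup>q\<bar>\<^sup>2\<close>; in terms of the
  Fourier transform \<open>D\<close> of the result, the equations of \<open>S\<^sub>1 \<union> S\<^sub>2\<close> say precisely that \<open>D\<close> is
  constant off \<open>0\<close>; by Fourier inversion the product is constant off \<open>0\<close> as well. Conversely, for these couplings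
  the sum of \<open>\<Prod>\<^sub>s (\<omega>\<^bsup>q a\<^sub>s\<^esup> - 1) / \<bar>1 - \<omega>\<^sup>q\<bar>\<^sup>2\<close> over \<open>q\<close> vanishes for all positive \<open>a\<^sub>s\<close> with sum \<open>N\<close>.
  These sums are the coefficients of the only monomials of \<open>\<Phi>(U, 0)\<close> that could fail to be
  invariant: after summation over the sites, a surviving monomial has mode sum \<open>0\<close> or \<open>\<plusminus>N\<close>.
\<close>

section \<open>Evaluation of multivariate polynomials\<close>

text \<open>The coefficient maps \<open>id\<close> and \<open>of_real\<close> and the evaluation
  maps themselves are homomorphisms of commutative semirings; treating them alike lets evaluations
  be composed.\<close>

locale semiring_hom =
  fixes h :: "'a::comm_semiring_1 \<Rightarrow> 'b::comm_semiring_1"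
  assumes hom_zero [simp]: "h 0 = 0"
    and hom_one [simp]: "h 1 = 1"
    and hom_add: "h (a + b) = h a + h b"
    and hom_mult: "h (a * b) = h a * h b"
begin

lemma hom_sum: "h (sum f A) = (\<Sum>i\<in>A. h (f i))"
  by (induction A rule: infinite_finite_induct) (simp_all add: hom_add)

lemma hom_prod: "h (prod f A) = (\<Prod>i\<in>A. h (f i))"
  by (induction A rule: infinite_finite_induct) (simp_all add: hom_mult)

lemma hom_power: "h (a ^ n) = h a ^ n"
  by (induction n) (simp_all add: hom_mult)

end

lemma semiring_hom_id: "semiring_hom id"
  by unfold_locales auto

lemma semiring_hom_of_real:
  "semiring_hom (of_real :: real \<Rightarrow> 'a::{real_algebra_1, comm_semiring_1})"
  by unfold_locales auto

lemma monom_eval_superset: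
  assumes "finite K" and "Poly_Mapping.keys e \<subseteq> K"
  shows "monom_eval x e = (\<Prod>v\<in>K. x v ^ Poly_Mapping.lookup e v)"
  unfolding monom_eval_def using assms
  by (intro prod.mono_neutral_left) (auto simp: in_keys_iff)

lemma monom_eval_add: "monom_eval x (a + b) = monom_eval x a * monom_eval x b"
proof -
  let ?K = "Poly_Mapping.keys a \<union> Poly_Mapping.keys b"
  have "monom_eval x (a + b) = (\<Prod>v\<in>?K. x v ^ Poly_Mapping.lookup (a + b) v)"
    by (intro monom_eval_superset) (use keys_add[of a b] in auto)
  also have "\<dots> = monom_eval x a * monom_eval x b"
    by (simp add: lookup_add power_add prod.distrib monom_eval_superset[of ?K])
  finally show ?thesis .
qed

lemma monom_eval_zero [simp]: "monom_eval x 0 = 1"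
  by (simp add: monom_eval_def)

lemma monom_eval_single: "monom_eval x (Poly_Mapping.single v n) = x v ^ n"
  by (auto simp: monom_eval_def)

lemma poly_mapping_sum_monomials:
  "P = (\<Sum>e\<in>Poly_Mapping.keys P. Poly_Mapping.single e (Poly_Mapping.lookup P e))"
proof (rule poly_mapping_eqI)
  fix k
  have "Poly_Mapping.lookup
      (\<Sum>e\<in>Poly_Mapping.keys P. Poly_Mapping.single e (Poly_Mapping.lookup P e)) k =
      (\<Sum>e\<in>Poly_Mapping.keys P. if e = k then Poly_Mapping.lookup P k else 0)"
    by (auto simp: lookup_sum lookup_single when_def intro!: sum.cong)
  also have "\<dots> = Poly_Mapping.lookup P k"
    by (auto simp: in_keys_iff)
  finally show "Poly_Mapping.lookup P k = Poly_Mapping.lookup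
      (\<Sum>e\<in>Poly_Mapping.keys P. Poly_Mapping.single e (Poly_Mapping.lookup P e)) k" ..
qed

context semiring_hom
begin

text \<open>Coefficients outside the support are zero and \<open>h 0 = 0\<close>, so two polynomials
  can be evaluated over one common finite index set.\<close>

lemma meval_superset:
  assumes "finite K" and "Poly_Mapping.keys P \<subseteq> K"
  shows "meval h x P = (\<Sum>e\<in>K. h (Poly_Mapping.lookup P e) * monom_eval x e)"
  unfolding meval_def using assms
  by (intro sum.mono_neutral_left) (auto simp: in_keys_iff)

lemma meval_add: "meval h x (P + Q) = meval h x P + meval h x Q"
proof -
  let ?K = "Poly_Mapping.keys P \<union> Poly_Mapping.keys Q"
  have "meval h x (P + Q) = (\<Sum>e\<in>?K. h (Poly_Mapping.lookup (P + Q) e) * monom_eval x e)"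
    by (intro meval_superset) (use keys_add[of P Q] in auto)
  also have "\<dots> = meval h x P + meval h x Q"
    by (simp add: lookup_add hom_add distrib_right sum.distrib meval_superset[of ?K])
  finally show ?thesis .
qed

lemma meval_zero [simp]: "meval h x 0 = 0"
  by (simp add: meval_def)

lemma meval_sum: "meval h x (sum f A) = (\<Sum>i\<in>A. meval h x (f i))"
  by (induction A rule: infinite_finite_induct) (simp_all add: meval_add)

lemma meval_single: "meval h x (Poly_Mapping.single e c) = h c * monom_eval x e"
  by (auto simp: meval_def)

lemma meval_mult: "meval h x (P * Q) = meval h x P * meval h x Q"
proof -
  have "P * Q = (\<Sum>e\<in>Poly_Mapping.keys P. \<Sum>e'\<in>Poly_Mapping.keys Q.
      Poly_Mapping.single (e + e') (Poly_Mapping.lookup P e * Poly_Mapping.lookup Q e'))"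
    by (subst poly_mapping_sum_monomials[of P], subst poly_mapping_sum_monomials[of Q])
       (simp add: sum_product mult_single)
  then have "meval h x (P * Q) = (\<Sum>e\<in>Poly_Mapping.keys P. \<Sum>e'\<in>Poly_Mapping.keys Q.
      h (Poly_Mapping.lookup P e * Poly_Mapping.lookup Q e') * monom_eval x (e + e'))"
    by (simp add: meval_sum meval_single)
  also have "\<dots> = meval h x P * meval h x Q"
    by (simp add: meval_def sum_product hom_mult monom_eval_add algebra_simps)
  finally show ?thesis .
qed

lemma meval_mconst: "meval h x (mconst c) = h c"
  by (simp add: mconst_def meval_single)

lemma meval_mvar: "meval h x (mvar v) = x v"
  by (simp add: mvar_def meval_single monom_eval_single)

lemma semiring_hom_meval: "semiring_hom (meval h x)"
proof
  show "meval h x 1 = 1"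
    using meval_mconst[of x 1] by (simp add: mconst_def)
qed (simp_all add: meval_add meval_mult)

end

text \<open>Homomorphisms pass through sums, products and powers. With \<open>g\<close> an
  evaluation this computes the values of a polynomial that arose by substitution, such as
  \<open>mode_potential\<close>.\<close>

lemma meval_comp:
  assumes "semiring_hom g"
  shows "g (meval h x P) = meval (\<lambda>c. g (h c)) (\<lambda>v. g (x v)) P"
proof -
  interpret semiring_hom g by fact
  show ?thesis
    by (simp add: meval_def monom_eval_def hom_sum hom_mult hom_prod hom_power)
qed

section \<open>Variables occurring in a polynomial\<close>

lemma mvars_add: "mvars (P + Q) \<subseteq> mvars P \<union> mvars Q"
  using keys_add[of P Q] by (auto simp: mvars_def)

lemma mvars_mult: "mvars (P * Q) \<subseteq> mvars P \<union> mvars Q"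
proof
  fix v assume "v \<in> mvars (P * Q)"
  then obtain e where "e \<in> Poly_Mapping.keys (P * Q)" "v \<in> Poly_Mapping.keys e"
    by (auto simp: mvars_def)
  moreover from this(1) obtain a b
    where "e = a + b" "a \<in> Poly_Mapping.keys P" "b \<in> Poly_Mapping.keys Q"
    using keys_mult[of P Q] by blast
  ultimately show "v \<in> mvars P \<union> mvars Q"
    using keys_add[of a b] by (auto simp: mvars_def)
qed

lemma mvars_power: "mvars (P ^ n) \<subseteq> mvars P"
proof (induction n)
  case 0
  show ?case by (simp add: mvars_def)
next
  case (Suc n)
  then show ?case using mvars_mult[of P "P ^ n"] by auto
qed

lemma mvars_sum: "mvars (sum f A) \<subseteq> (\<Union>i\<in>A. mvars (f i))"
  using keys_sum[of f A] by (fastforce simp: mvars_def)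

lemma mvars_mconst [simp]: "mvars (mconst c) = {}"
  by (simp add: mvars_def mconst_def)

lemma mvars_mvar [simp]: "mvars (mvar v :: ('v, 'a::zero_neq_one) mpoly) = {v}"
  by (simp add: mvars_def mvar_def)

lemma mvars_diff: "mvars (P - Q :: ('v, 'a::ab_group_add) mpoly) \<subseteq> mvars P \<union> mvars Q"
proof -
  have "Poly_Mapping.keys (P - Q) \<subseteq> Poly_Mapping.keys P \<union> Poly_Mapping.keys Q"
    by (auto simp: in_keys_iff lookup_minus)
  then show ?thesis by (auto simp: mvars_def)
qed

section \<open>Roots of unity\<close>

definition unity_root :: "nat \<Rightarrow> int \<Rightarrow> complex" where
  "unity_root N k = cis (2 * pi * of_int k / of_nat N)"

lemma unity_root_0 [simp]: "unity_root N 0 = 1"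
  by (simp add: unity_root_def)

lemma unity_root_add: "unity_root N (j + k) = unity_root N j * unity_root N k"
  by (simp add: unity_root_def cis_mult add_divide_distrib ring_distribs)

lemma unity_root_uminus: "unity_root N (- k) = inverse (unity_root N k)"
  by (simp add: unity_root_def)

lemma unity_root_diff: "unity_root N (j - k) = unity_root N j / unity_root N k"
  using unity_root_add[of N j "- k"] by (simp add: unity_root_uminus field_simps)

lemma unity_root_nz [simp]: "unity_root N k \<noteq> 0"
  by (simp add: unity_root_def)

lemma unity_root_power: "unity_root N k ^ n = unity_root N (int n * k)"
  by (simp only: unity_root_def Complex.DeMoivre) (simp add: mult_ac)

lemma unity_root_eq_1_iff:
  assumes "N > 0"
  shows "unity_root N k = 1 \<longleftrightarrow> int N dvd k"
proof
  assume "int N dvd k"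
  then obtain m where "k = int N * m" ..
  then have "unity_root N k = cis (2 * pi * of_int m)"
    using assms by (simp add: unity_root_def field_simps)
  then show "unity_root N k = 1" by simp
next
  assume "unity_root N k = 1"
  then have "cos (2 * pi * of_int k / of_nat N) = 1"
    by (simp add: unity_root_def complex_eq_iff)
  then obtain m :: int where "2 * pi * of_int k / of_nat N = of_int m * 2 * pi"
    by (auto simp: cos_one_2pi_int)
  then have "real_of_int k = real_of_int (m * int N)"
    using assms by (simp add: field_simps)
  then have "k = m * int N"
    by (simp only: of_int_eq_iff)
  then show "int N dvd k" by simp
qed

lemma unity_root_cong:
  assumes "N > 0" and "int N dvd j - k"
  shows "unity_root N j = unity_root N k"
  using assms unity_root_eq_1_iff[of N "j - k"] by (simp add: unity_root_diff)

section \<open>Character sums and Fourier inversion\<close>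

lemma sum_unity_root_power:
  assumes "N > 0"
  shows "(\<Sum>r<N. unity_root N (int r * k)) = (if int N dvd k then of_nat N else 0)"
proof (cases "int N dvd k")
  case True
  then have "unity_root N (int r * k) = 1" for r
    using assms by (simp add: unity_root_eq_1_iff)
  then show ?thesis using True by simp
next
  case False
  have "(\<Sum>r<N. unity_root N (int r * k)) = (\<Sum>r<N. unity_root N k ^ r)"
    by (simp add: unity_root_power)
  also have "\<dots> = 0"
    using False assms
    by (subst geometric_sum) (auto simp: unity_root_eq_1_iff unity_root_power)
  finally show ?thesis using False by simp
qed

lemma sum_atLeast1AtMost_periodic:
  fixes f :: "nat \<Rightarrow> 'a::comm_monoid_add"
  assumes "f N = f 0" and "N > 0"
  shows "(\<Sum>n=1..N. f n) = (\<Sum>n<N. f n)"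
proof -
  have "{1..N} = insert N {1..<N}" and "{..<N} = insert 0 {1..<N}"
    using assms(2) by auto
  then show ?thesis using assms by simp
qed

lemma sum_unity_root_power':
  assumes "N > 0"
  shows "(\<Sum>n=1..N. unity_root N (int n * k)) = (if int N dvd k then of_nat N else 0)"
  using sum_atLeast1AtMost_periodic[of "\<lambda>n. unity_root N (int n * k)" N] assms
    sum_unity_root_power[OF assms, of k] by (simp add: unity_root_eq_1_iff)

text \<open>By Fourier inversion, \<open>N d s = D 0 - C\<close> for \<open>s \<noteq> 0\<close>, where \<open>D\<close> is the transform of \<open>d\<close>.\<close>

lemma constant_if_dft_constant:
  fixes d :: "nat \<Rightarrow> complex"
  assumes N: "N > 0"
    and const: "\<And>k. 0 < k \<Longrightarrow> k < N \<Longrightarrow> (\<Sum>r<N. d r * unity_root N (int r * int k)) = C"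
    and s: "0 < s" "s < N" and t: "0 < t" "t < N"
  shows "d s = d t"
proof -
  define D where "D k = (\<Sum>r<N. d r * unity_root N (int r * int k))" for k
  have inv: "of_nat N * d u = D 0 - C" if u: "0 < u" "u < N" for u
  proof -
    have "(\<Sum>k<N. D k * unity_root N (- (int k * int u))) =
        (\<Sum>k<N. \<Sum>r<N. d r * unity_root N (int k * (int r - int u)))"
      by (simp add: D_def sum_distrib_left sum_distrib_right algebra_simps unity_root_diff
          unity_root_uminus divide_inverse)
    also have "\<dots> = (\<Sum>r<N. d r * (\<Sum>k<N. unity_root N (int k * (int r - int u))))"
      by (subst sum.swap) (simp add: sum_distrib_left)
    also have "\<dots> = (\<Sum>r<N. if r = u then d r * of_nat N else 0)"
    proof (intro sum.cong refl)
      fix r assume "r \<in> {..<N}"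
      then have "\<bar>int r - int u\<bar> < int N" using u by auto
      then have "int N dvd int r - int u \<longleftrightarrow> r = u"
        using dvd_imp_le_int[of "int r - int u" "int N"] by auto
      then show "d r * (\<Sum>k<N. unity_root N (int k * (int r - int u))) =
          (if r = u then d r * of_nat N else 0)"
        by (simp add: sum_unity_root_power[OF N])
    qed
    also have "\<dots> = of_nat N * d u" using u by simp
    finally have 1: "of_nat N * d u = (\<Sum>k<N. D k * unity_root N (- (int k * int u)))" ..
    have "{..<N} = insert 0 {1..<N}" using N by auto
    then have 2: "(\<Sum>k<N. g k) = g 0 + (\<Sum>k\<in>{1..<N}. g k)" for g :: "nat \<Rightarrow> complex"
      by simp
    have "\<not> int N dvd - int u" using u by (auto dest: dvd_imp_le_int)
    then have "(\<Sum>k<N. unity_root N (- (int k * int u))) = 0"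
      using sum_unity_root_power[OF N, of "- int u"] by simp
    \<comment> \<open>\<open>D k = C\<close> is known only for \<open>k \<noteq> 0\<close>. The term
      \<open>k = 0\<close> is set apart, and the remaining characters add up to
      \<open>-1\<close>.\<close>
    then have "(\<Sum>k\<in>{1..<N}. unity_root N (- (int k * int u))) = -1"
      by (simp add: 2 add_eq_0_iff)
    then show ?thesis
      by (simp add: 1 2 const[folded D_def] flip: sum_distrib_left)
  qed
  have "of_nat N * d s = of_nat N * d t"
    using inv[OF s] inv[OF t] by simp
  then show ?thesis using N by simp
qed

section \<open>The linear system for the couplings\<close>

text \<open>The part of a quartic monomial's coefficient that comes from bonds of length
  \<open>r\<close>: a shift by \<open>r\<close> sites multiplies the mode with shifted index
  \<open>a\<close> by \<open>\<omega>^(r a)\<close>.\<close>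

definition mode_factor :: "nat \<Rightarrow> nat \<Rightarrow> int \<times> int \<times> int \<times> int \<Rightarrow> complex" where
  "mode_factor N r = (\<lambda>(i, j, k, l).
     (unity_root N (int r * i) - 1) * (unity_root N (int r * j) - 1) *
     (unity_root N (int r * k) - 1) * (unity_root N (int r * l) - 1))"

text \<open>This is \<open>\<bar>1 - \<omega>^r\<bar>^2\<close>, written in roots of unity so that
  it can be matched with factors \<open>\<omega>^r - 1\<close>.\<close>

definition mode_weight :: "nat \<Rightarrow> nat \<Rightarrow> complex" where
  "mode_weight N r = 2 - unity_root N (int r) - unity_root N (- int r)"

lemma mode_weight_eq: "mode_weight N r = of_real (4 * (sin (real r * pi / real N))\<^sup>2)"
proof -
  have "mode_weight N r = of_real (2 - 2 * cos (2 * (real r * pi / real N)))"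
    by (simp add: mode_weight_def unity_root_def complex_eq_iff mult_ac)
  also have "2 - 2 * cos (2 * (real r * pi / real N)) = 4 * (sin (real r * pi / real N))\<^sup>2"
    by (subst cos_double_sin) simp
  finally show ?thesis .
qed

text \<open>With \<open>z = \<omega>^r\<close>, the two indices 1 contribute
  \<open>(z - 1)^2 = - z * mode_weight N r\<close>; multiplying out the rest leaves four single
  powers. Summed against the couplings, these become four Fourier coefficients.\<close>

lemma weighted_mode_factor_S2:
  assumes "N > 0"
  shows "mode_factor N r (int N - 2 - k, k, 1, 1) = mode_weight N r *
    (unity_root N (int r * (k + 1)) + unity_root N (int r * (- (k + 1))) -
     unity_root N (int r * 1) - unity_root N (int r * - 1))"
proof -
  define z y where "z = unity_root N (int r)" and "y = unity_root N (int r * k)"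
  have [simp]: "z \<noteq> 0" "y \<noteq> 0" by (simp_all add: z_def y_def)
  have "unity_root N (int r * (int N - 2 - k)) = unity_root N (- int r - int r - int r * k)"
    by (rule unity_root_cong[OF assms]) (simp add: algebra_simps)
  also have "\<dots> = 1 / (z * z * y)"
    by (simp only: unity_root_diff unity_root_uminus z_def y_def) (simp add: field_simps)
  finally have 1: "unity_root N (int r * (int N - 2 - k)) = 1 / (z * z * y)" .
  have 2: "unity_root N (int r * (k + 1)) = y * z"
    "unity_root N (int r * (- (k + 1))) = 1 / (y * z)"
    using unity_root_add[of N "int r * k" "int r"]
      unity_root_uminus[of N "int r * (k + 1)"]
    by (simp_all add: y_def z_def algebra_simps divide_inverse)
  have 3: "mode_weight N r = 2 - z - 1 / z"
    by (simp add: mode_weight_def z_def unity_root_uminus divide_inverse)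
  show ?thesis
    unfolding mode_factor_def prod.case 1 2 3 mult_1_right y_def[symmetric] z_def[symmetric]
    by (simp add: unity_root_uminus field_simps flip: z_def)
qed

text \<open>One such product shows only a single factor \<open>z - 1\<close>. The difference of
  consecutive \<open>n\<close> supplies the second one, and \<open>e * e = 1\<close> for the
  half-period root \<open>e\<close> reduces the remainder to four single powers.\<close>

lemma mode_factor_S1_diff:
  assumes "N > 0" and "N = 2 * M"
  shows "mode_factor N r (int M, int M - n - 1, n, 1) -
      mode_factor N r (int M, int M - (n - 1) - 1, n - 1, 1) =
    - mode_weight N r * (unity_root N (int r * n) + unity_root N (int r * - n) -
      unity_root N (int r * (int M - n)) - unity_root N (int r * (int M + n)))"
proof -
  define z u e where "z = unity_root N (int r)" and "u = unity_root N (int r * n)"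
    and "e = unity_root N (int r * int M)"
  have [simp]: "z \<noteq> 0" "u \<noteq> 0" by (simp_all add: z_def u_def)
  have "e * e = unity_root N (int r * int N)"
    by (simp add: e_def assms(2) algebra_simps flip: unity_root_add)
  then have e: "e * e = 1" using assms(1) by (simp add: unity_root_eq_1_iff)
  have "unity_root N (int r * (int M - n - 1)) = e / (u * z)"
    "unity_root N (int r * (int M - (n - 1) - 1)) = e / u"
    "unity_root N (int r * (n - 1)) = u / z"
    "unity_root N (int r * (int M - n)) = e / u"
    "unity_root N (int r * (int M + n)) = e * u"
    "unity_root N (int r * - n) = 1 / u"
    "mode_weight N r = 2 - z - 1 / z"
    by (simp_all add: mode_weight_def right_diff_distrib distrib_left unity_root_diff
        unity_root_add unity_root_uminus divide_inverse z_def u_def e_def)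
  note 1 = this
  have "(e - 1) * (e / (u * z) - 1) * (u - 1) * (z - 1) -
        (e - 1) * (e / u - 1) * (u / z - 1) * (z - 1) =
      - (2 - z - 1 / z) * ((e - 1) * (e / u - u))"
    by (simp add: field_simps)
  also have "(e - 1) * (e / u - u) = u + 1 / u - e / u - e * u"
    using e by (simp add: algebra_simps diff_divide_distrib)
  finally show ?thesis
    unfolding mode_factor_def prod.case 1 mult_1_right
      u_def[symmetric] e_def[symmetric] z_def[symmetric] .
qed

lemma mode_factor_0 [simp]: "mode_factor N 0 a = 0"
  by (cases a) (simp add: mode_factor_def)

lemma mode_weight_0 [simp]: "mode_weight N 0 = 0"
  by (simp add: mode_weight_def)

lemma sum_reflect:
  fixes f :: "nat \<Rightarrow> 'a::comm_monoid_add"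
  assumes "N > 0"
  shows "(\<Sum>r\<in>{1..<N}. f (N - r)) = (\<Sum>r\<in>{1..<N}. f r)"
  by (rule sum.reindex_bij_witness[of _ "\<lambda>r. N - r" "\<lambda>r. N - r"]) auto

text \<open>With \<open>D\<close> the Fourier transform of \<open>\<beta>\<close> times the weight \<open>\<bar>1 - \<omega>\<^sup>r\<bar>\<^sup>2\<close>, the equations of
  \<open>S\<^sub>2\<close> read \<open>D k = D 1\<close>, and differences of consecutive equations of \<open>S\<^sub>1\<close> read
  \<open>D n = D (N/2 - n)\<close>.\<close>

lemma mode_system_solution:
  fixes \<beta> :: "nat \<Rightarrow> complex"
  assumes N: "N = 2 * M" "M = 2 * K" "K > 0"
    and sym: "\<And>r. 0 < r \<Longrightarrow> r < N \<Longrightarrow> \<beta> (N - r) = \<beta> r"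
    and S1: "\<And>n. 1 \<le> n \<Longrightarrow> n \<le> int K - 1 \<Longrightarrow>
      (\<Sum>r<N. \<beta> r * mode_factor N r (int M, int M - n - 1, n, 1)) = 0"
    and S2: "\<And>m. m = 1 \<or> 3 \<le> m \<and> m \<le> int K + 1 \<Longrightarrow>
      (\<Sum>r<N. \<beta> r * mode_factor N r (int M + m - 2, int M - m, 1, 1)) = 0"
    and s: "0 < s" "s < N" and t: "0 < t" "t < N"
  shows "\<beta> s * mode_weight N s = \<beta> t * mode_weight N t"
proof -
  have N0: "N > 0" using N by simp
  define d where "d r = \<beta> r * mode_weight N r" for r
  define D where "D k = (\<Sum>r<N. d r * unity_root N (int r * k))" for k
  have split: "(\<Sum>r<N. g r) = g 0 + (\<Sum>r\<in>{1..<N}. g r)" for g :: "nat \<Rightarrow> complex"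
  proof -
    have "{..<N} = insert 0 {1..<N}" using N0 by auto
    then show ?thesis by simp
  qed
  have D_periodic: "D (k + int N * j) = D k" for k j
    unfolding D_def
    by (intro sum.cong refl arg_cong2[where f = "(*)"] unity_root_cong N0)
       (simp add: algebra_simps)
  \<comment> \<open>The vanishing term \<open>r = 0\<close> is dropped first, because the reflection
    \<open>r -> N - r\<close> acts on the range from \<open>1\<close> to
    \<open>N - 1\<close>.\<close>
  have D_neg: "D (- k) = D k" for k
  proof -
    have "D (- k) = (\<Sum>r\<in>{1..<N}. d r * unity_root N (int r * - k))"
      by (simp add: D_def split d_def)
    also have "\<dots> = (\<Sum>r\<in>{1..<N}. d (N - r) * unity_root N (int (N - r) * - k))"
      by (rule sum_reflect[symmetric, OF N0])
    also have "\<dots> = (\<Sum>r\<in>{1..<N}. d r * unity_root N (int r * k))"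
    proof (intro sum.cong refl arg_cong2[where f = "(*)"])
      fix r assume r: "r \<in> {1..<N}"
      then have "unity_root N (int (N - r)) = unity_root N (- int r)"
        "unity_root N (- int (N - r)) = unity_root N (int r)"
        by (auto intro!: unity_root_cong N0 simp: of_nat_diff)
      then show "d (N - r) = d r"
        using r sym[of r] by (simp add: d_def mode_weight_def)
      show "unity_root N (int (N - r) * - k) = unity_root N (int r * k)"
        using r by (intro unity_root_cong N0) (auto simp: of_nat_diff algebra_simps)
    qed
    also have "\<dots> = D k" by (simp add: D_def split d_def)
    finally show ?thesis .
  qed
  have D_reflect: "D (int N - k) = D k" for k
    using D_periodic[of "- k" 1] D_neg[of k] by (simp add: algebra_simps)
  have eq2: "D (int M - m + 1) = D 1" if "m = 1 \<or> 3 \<le> m \<and> m \<le> int K + 1" for m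
  proof -
    have "0 = (\<Sum>r<N. \<beta> r * mode_factor N r (int N - 2 - (int M - m), int M - m, 1, 1))"
      using S2[OF that] N by (simp add: algebra_simps)
    also have "\<dots> = D (int M - m + 1) + D (- (int M - m + 1)) - D 1 - D (- 1)"
      unfolding weighted_mode_factor_S2[OF N0] D_def d_def
      by (simp add: algebra_simps sum.distrib sum_subtractf)
    finally show ?thesis unfolding D_neg by simp
  qed
  define G where "G n = (\<Sum>r<N. \<beta> r * mode_factor N r (int M, int M - n - 1, n, 1))" for n
  have G_diff: "G n - G (n - 1) = - 2 * (D n - D (int M - n))" for n
  proof -
    have "G n - G (n - 1) = - (D n + D (- n) - D (int M - n) - D (int M + n))"
      unfolding G_def sum_subtractf[symmetric] right_diff_distrib[symmetric]
        mode_factor_S1_diff[OF N0 N(1)] D_def d_def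
      by (simp add: algebra_simps sum.distrib sum_subtractf sum_negf)
    moreover have "D (int M + n) = D (int M - n)"
      using D_reflect[of "int M - n"] N by (simp add: algebra_simps)
    ultimately show ?thesis by (simp add: D_neg)
  qed
  \<comment> \<open>The equations begin at \<open>n = 1\<close>; at \<open>n = 0\<close> the product
    vanishes because it contains \<open>\<omega>^0 - 1\<close>. Hence the difference at
    \<open>n = 1\<close> is available as well.\<close>
  have G0: "G n = 0" if "0 \<le> n" "n \<le> int K - 1" for n
  proof (cases "n = 0")
    case True
    then show ?thesis by (simp add: G_def mode_factor_def)
  next
    case False
    then show ?thesis using S1[of n] that by (simp add: G_def)
  qed
  have eq1: "D n = D (int M - n)" if "1 \<le> n" "n \<le> int K - 1" for n
    using G_diff[of n] G0[of n] G0[of "n - 1"] that by simp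
  \<comment> \<open>\<open>eq2\<close> reaches every \<open>k\<close> from \<open>K\<close> to
    \<open>M\<close> except \<open>M - 1\<close>, which would need the excluded
    \<open>m = 2\<close>. That value comes from \<open>eq1\<close> at \<open>n = 1\<close>, or is
    \<open>1\<close> itself when \<open>K = 1\<close>.\<close>
  have high: "D k = D 1" if "int K \<le> k" "k \<le> int M" for k
  proof (cases "k = int M - 1")
    case True
    show ?thesis
    proof (cases "K = 1")
      case True
      then show ?thesis using \<open>k = int M - 1\<close> N by simp
    next
      case False
      then show ?thesis using eq1[of 1] \<open>k = int M - 1\<close> N by simp
    qed
  next
    case False
    then have "int M - k + 1 = 1 \<or> 3 \<le> int M - k + 1 \<and> int M - k + 1 \<le> int K + 1"
      using that N(2) by presburger
    from eq2[OF this] show ?thesis by simp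
  qed
  \<comment> \<open>Below \<open>K\<close> the reflection \<open>k -> M - k\<close> of
    \<open>eq1\<close> leads into the range already settled.\<close>
  have low: "D k = D 1" if "1 \<le> k" "k \<le> int M" for k
  proof (cases "int K \<le> k")
    case False
    then show ?thesis using eq1[of k] high[of "int M - k"] that N by simp
  qed (use high that in auto)
  have "D (int k) = D 1" if "0 < k" "k < N" for k
  proof (cases "k \<le> M")
    case False
    then show ?thesis using low[of "int N - int k"] D_reflect[of "int k"] that N by simp
  qed (use low[of "int k"] that in auto)
  then have "d s = d t"
    unfolding D_def by (intro constant_if_dft_constant[OF N0 _ s t]) auto
  then show ?thesis by (simp add: d_def)
qed

text \<open>Away from \<open>r = 0\<close> the summand is a polynomial in \<open>\<omega>\<^sup>r\<close> all of whose exponents lie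
  strictly between \<open>0\<close> and \<open>N\<close>, and this polynomial vanishes at \<open>r = 0\<close>.\<close>

lemma sum_mode_factor_eq_0:
  assumes N: "N > 0"
    and pos: "i > 0" "j > 0" "k > 0" "l > 0"
    and sum: "i + j + k + l = int N"
  shows "(\<Sum>r\<in>{1..<N}. mode_factor N r (i, j, k, l) / mode_weight N r) = 0"
proof -
  define c d where "c = nat k" and "d = nat l"
  have kl: "k = int c" "l = int d" using pos by (simp_all add: c_def d_def)
  let ?w = "unity_root N"
  \<comment> \<open>For \<open>r > 0\<close> the weight is \<open>- (z - 1)^2 / z\<close> with
    \<open>z = \<omega>^r\<close>. It cancels the factors \<open>z - 1\<close> split off from the
    indices \<open>k\<close> and \<open>l\<close>, whose geometric sums remain in
    \<open>P\<close>.\<close>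
  define P where "P r = - (?w (int r)) * (?w (int r * i) - 1) * (?w (int r * j) - 1) *
      ((\<Sum>x<c. ?w (int r) ^ x) * (\<Sum>y<d. ?w (int r) ^ y))" for r
  have "mode_factor N r (i, j, k, l) / mode_weight N r = P r" if r: "r \<in> {1..<N}" for r
  proof -
    define z where "z = ?w (int r)"
    have "z \<noteq> 1"
      using r N by (auto simp: z_def unity_root_eq_1_iff dest: zdvd_imp_le)
    moreover have [simp]: "z \<noteq> 0" by (simp add: z_def)
    have k: "?w (int r * k) - 1 = (z - 1) * (\<Sum>x<c. z ^ x)"
      and l: "?w (int r * l) - 1 = (z - 1) * (\<Sum>y<d. z ^ y)"
      using power_diff_1_eq[of z c] power_diff_1_eq[of z d]
      by (simp_all add: kl z_def unity_root_power mult.commute)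
    have W: "mode_weight N r = - ((z - 1) * (z - 1)) / z"
      by (simp add: mode_weight_def unity_root_uminus field_simps flip: z_def)
    have "A * B * (q * S) * (q * T) / (- (q * q) / z) = - z * A * B * (S * T)"
      if "q \<noteq> 0" for A B S T q
      using that by (simp add: field_simps)
    then show ?thesis
      unfolding mode_factor_def prod.case P_def k l W z_def[symmetric]
      using \<open>z \<noteq> 1\<close> by simp
  qed
  then have "(\<Sum>r\<in>{1..<N}. mode_factor N r (i, j, k, l) / mode_weight N r) =
      (\<Sum>r\<in>{1..<N}. P r)" by simp
  also have "\<dots> = (\<Sum>r<N. P r)"
    by (rule sum.mono_neutral_left) (auto simp: P_def Suc_le_eq)
  also have "\<dots> = (\<Sum>r<N. \<Sum>x<c. \<Sum>y<d.
      - ?w (int r * (1 + int x + int y + i + j)) + ?w (int r * (1 + int x + int y + i))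
      + ?w (int r * (1 + int x + int y + j)) - ?w (int r * (1 + int x + int y)))"
  proof (intro sum.cong refl)
    fix r
    show "P r = (\<Sum>x<c. \<Sum>y<d.
      - ?w (int r * (1 + int x + int y + i + j)) + ?w (int r * (1 + int x + int y + i))
      + ?w (int r * (1 + int x + int y + j)) - ?w (int r * (1 + int x + int y)))"
      unfolding P_def sum_product unfolding sum_distrib_left
      by (intro sum.cong refl)
         (simp add: unity_root_power unity_root_add distrib_left algebra_simps)
  qed
  also have "\<dots> = (\<Sum>x<c. \<Sum>y<d. \<Sum>r<N.
      - ?w (int r * (1 + int x + int y + i + j)) + ?w (int r * (1 + int x + int y + i))
      + ?w (int r * (1 + int x + int y + j)) - ?w (int r * (1 + int x + int y)))"
    by (subst sum.swap) (intro sum.cong refl sum.swap)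
  also have "\<dots> = 0"
  proof (rule sum.neutral, rule ballI, rule sum.neutral, rule ballI)
    fix x y assume xy: "x \<in> {..<c}" "y \<in> {..<d}"
    \<comment> \<open>The exponents range from \<open>1\<close> to
      \<open>1 + (k - 1) + (l - 1) + i + j = N - 1\<close>, so none of them is divisible by
      \<open>N\<close>.\<close>
    have z: "(\<Sum>r<N. ?w (int r * e)) = 0" if "0 < e" "e < int N" for e
      using that sum_unity_root_power[OF N, of e] by (auto dest: zdvd_imp_le)
    show "(\<Sum>r<N. - ?w (int r * (1 + int x + int y + i + j)) +
        ?w (int r * (1 + int x + int y + i)) +
        ?w (int r * (1 + int x + int y + j)) - ?w (int r * (1 + int x + int y))) = 0"
      unfolding sum.distrib sum_subtractf sum_negf
      using z[of "1 + int x + int y + i + j"] z[of "1 + int x + int y + i"]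
        z[of "1 + int x + int y + j"] z[of "1 + int x + int y"] xy pos sum kl
      by simp
  qed
  finally show ?thesis .
qed

section \<open>From the half range of distances to sums over the ring\<close>

text \<open>The couplings as a function on the ring \<open>\<int>/N\<close>; distance \<open>N/2\<close> is counted only once by the
  equations but is its own reflection, whence the factor \<open>2\<close>.\<close>

definition ring_coupling :: "nat \<Rightarrow> (nat \<Rightarrow> real) \<Rightarrow> nat \<Rightarrow> real" where
  "ring_coupling N b r =
     (if 2 * r < N then b r else if 2 * r = N then 2 * b r else b (N - r))"

lemma ring_coupling_reflect:
  assumes "r < N"
  shows "ring_coupling N b (N - r) = ring_coupling N b r"
  using assms by (cases "r = 0") (auto simp: ring_coupling_def)

text \<open>The ring is folded onto the distances up to \<open>M\<close>: each \<open>r < M\<close>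
  occurs together with \<open>N - r\<close>, and the antipode \<open>M\<close> occurs once but with
  its doubled value.\<close>

lemma sum_ring_coupling:
  fixes g :: "nat \<Rightarrow> complex"
  assumes N: "N = 2 * M" "M > 0"
    and g: "\<And>r. 0 < r \<Longrightarrow> r < N \<Longrightarrow> g (N - r) = g r"
  shows "(\<Sum>r\<in>{1..<N}. of_real (ring_coupling N b r) * g r) =
    2 * (\<Sum>r=1..M. of_real (b r) * g r)"
proof -
  let ?f = "\<lambda>r. of_real (ring_coupling N b r) * g r"
  have refl: "(\<Sum>r\<in>{M<..<N}. ?f r) = (\<Sum>r\<in>{1..<M}. ?f r)"
  proof (rule sum.reindex_bij_witness[of _ "\<lambda>r. N - r" "\<lambda>r. N - r"])
    fix r assume "r \<in> {M<..<N}"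
    then show "?f (N - r) = ?f r"
      using ring_coupling_reflect[of r N b] g[of r] by auto
  qed (use N in auto)
  have "{1..<N} = {1..<M} \<union> ({M} \<union> {M<..<N})" using N by auto
  then have "(\<Sum>r\<in>{1..<N}. ?f r) = (\<Sum>r\<in>{1..<M}. ?f r) + (?f M + (\<Sum>r\<in>{M<..<N}. ?f r))"
    by (simp only:) (subst sum.union_disjoint; auto)+
  also have "\<dots> = 2 * ((\<Sum>r\<in>{1..<M}. ?f r) + of_real (b M) * g M)"
    unfolding refl using N by (simp add: ring_coupling_def)
  also have "(\<Sum>r\<in>{1..<M}. ?f r) = (\<Sum>r\<in>{1..<M}. of_real (b r) * g r)"
    using N by (intro sum.cong) (auto simp: ring_coupling_def)
  also have "\<dots> + of_real (b M) * g M = (\<Sum>r=1..M. of_real (b r) * g r)"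
  proof -
    have "{1..M} = insert M {1..<M}" using N by auto
    then show ?thesis by simp
  qed
  finally show ?thesis .
qed

text \<open>Passing to \<open>N - r\<close> inverts each root \<open>x\<close>, and
  \<open>1 / x - 1 = - (x - 1) / x\<close>. The four signs cancel, and the four roots have product 1
  by the divisibility of the index sum.\<close>

lemma mode_factor_reflect:
  assumes "N > 0" and "r \<le> N" and "int N dvd i + j + k + l"
  shows "mode_factor N (N - r) (i, j, k, l) = mode_factor N r (i, j, k, l)"
proof -
  have inv: "unity_root N (int (N - r) * m) = 1 / unity_root N (int r * m)" for m
  proof -
    have "unity_root N (int (N - r) * m) = unity_root N (- (int r * m))"
      using assms by (intro unity_root_cong) (auto simp: of_nat_diff algebra_simps)
    then show ?thesis by (simp add: unity_root_uminus divide_inverse)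
  qed
  have "unity_root N (int r * (i + j + k + l)) = 1"
    using assms by (simp add: unity_root_eq_1_iff)
  then have prod: "unity_root N (int r * i) * unity_root N (int r * j) *
      unity_root N (int r * k) * unity_root N (int r * l) = 1"
    by (simp add: distrib_left unity_root_add)
  have flip: "(1 / x - 1) = - (x - 1) / x" if "x \<noteq> 0" for x :: complex
    using that by (simp add: field_simps)
  show ?thesis
    unfolding mode_factor_def prod.case inv using prod
    by (simp add: flip) (simp add: algebra_simps)
qed

lemma cis_double_minus_one: "cis (2 * t) - 1 = 2 * \<i> * of_real (sin t) * cis t"
  by (simp add: complex_eq_iff cos_double_sin sin_double power2_eq_square)

text \<open>By the half-angle formula each factor is
  \<open>2 * \<i> * sin (t m) * cis (t m)\<close>, with \<open>t m\<close> half the angle of the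
  root. The constants give 16, the index sum makes the phases multiply to \<open>(-1)^r\<close>, and
  the quarter turns \<open>pi * r / 2\<close> produce cosines for odd \<open>r\<close> and sines for
  even \<open>r\<close>.\<close>

lemma mode_factor_eq_fq:
  assumes N: "N = 2 * M" "M > 0" and sum: "i + j + k + l = int N"
  shows "mode_factor N r (int M - i, int M - j, int M - k, int M - l) =
    of_real (16 * ((-1) ^ r * fq N r (i, j, k, l)))"
proof -
  define t where "t m = pi * real r / 2 - of_int (m * int r) * pi / real N" for m :: int
  have factor: "unity_root N (int r * (int M - m)) - 1 =
      2 * \<i> * of_real (sin (t m)) * cis (t m)" for m
  proof -
    have "2 * pi * of_int (int r * (int M - m)) / real N = 2 * t m"
      using N by (simp add: t_def field_simps)
    then show ?thesis
      unfolding unity_root_def by (simp only: cis_double_minus_one)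
  qed
  have "t i + t j + t k + t l = 2 * pi * real r - of_int ((i + j + k + l) * int r) * pi / real N"
    by (simp add: t_def algebra_simps add_divide_distrib)
  also have "\<dots> = pi * real r"
    unfolding sum using N by (simp add: field_simps)
  finally have "cis (t i) * cis (t j) * cis (t k) * cis (t l) = cis pi ^ r"
    by (simp only: cis_mult Complex.DeMoivre) (simp add: mult_ac)
  then have c: "cis (t i) * cis (t j) * cis (t k) * cis (t l) = (-1) ^ r" by simp
  have s: "sin (t i) * sin (t j) * sin (t k) * sin (t l) = fq N r (i, j, k, l)"
  proof (cases "odd r")
    case True
    then obtain p where "r = 2 * p + 1" by (auto elim: oddE)
    \<comment> \<open>The sign enters the product four times and cancels; the same happens in the
      even case.\<close>
    then have "sin (t m) = (-1) ^ p * cN N (m * int r)" for m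
      by (simp add: t_def cN_def sin_diff cos_diff sin_add cos_add distrib_left
          add_divide_distrib mult.commute[of pi])
    then show ?thesis using True
      by (simp add: fq_def power2_eq_square flip: power_mult_distrib power_mult)
  next
    case False
    then obtain p where "r = 2 * p" by (auto elim: evenE)
    then have "sin (t m) = - ((-1) ^ p) * sN N (m * int r)" for m
      by (simp add: t_def sN_def sin_diff mult.commute[of pi])
    then show ?thesis using False
      by (simp add: fq_def power2_eq_square flip: power_mult_distrib power_mult)
  qed
  have "mode_factor N r (int M - i, int M - j, int M - k, int M - l) =
      16 * of_real (sin (t i) * sin (t j) * sin (t k) * sin (t l)) *
      (cis (t i) * cis (t j) * cis (t k) * cis (t l))"
    unfolding mode_factor_def prod.case factor
    by (simp add: algebra_simps)
  then show ?thesis unfolding c s by (simp add: mult_ac)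
qed

text \<open>The factor 16 of \<open>mode_factor_eq_fq\<close> and the factor 2 from folding the ring
  give 32; the minus sign is that of \<open>\<psi>\<close>.\<close>

lemma psi_eq_ring_sum:
  assumes N: "N = 2 * M" "M > 0" and sum: "i + j + k + l = int N"
  shows "of_real (\<psi> N (i, j, k, l) b) = - 1 / 32 *
    (\<Sum>r<N. of_real (ring_coupling N b r) *
      mode_factor N r (int M - i, int M - j, int M - k, int M - l))"
proof -
  let ?F = "\<lambda>r. mode_factor N r (int M - i, int M - j, int M - k, int M - l)"
  have "{..<N} = insert 0 {1..<N}" using N by auto
  then have "(\<Sum>r<N. of_real (ring_coupling N b r) * ?F r) =
      (\<Sum>r\<in>{1..<N}. of_real (ring_coupling N b r) * ?F r)" by simp
  also have "\<dots> = 2 * (\<Sum>r=1..M. of_real (b r) * ?F r)"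
  proof (rule sum_ring_coupling[OF N])
    have eq: "int M - i + (int M - j) + (int M - k) + (int M - l) = int N"
      using sum N by simp
    fix r assume "0 < r" "r < N"
    moreover have "int N dvd int M - i + (int M - j) + (int M - k) + (int M - l)"
      unfolding eq by simp
    ultimately show "?F (N - r) = ?F r"
      by (intro mode_factor_reflect) auto
  qed
  also have "\<dots> = - 32 * of_real (\<psi> N (i, j, k, l) b)"
    unfolding mode_factor_eq_fq[OF N sum] \<psi>_def
    using N by (simp add: sum_distrib_left sum_negf mult_ac)
  finally show ?thesis by simp
qed

section \<open>Couplings inversely proportional to the squared sine\<close>

lemma sin_ring_pos:
  assumes "0 < r" and "r < N"
  shows "sin (real r * pi / real N) > 0"
  using assms by (intro sin_gt_zero) (auto simp: field_simps)

text \<open>Formulated on the ring and free of division. The doubled value of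
  \<open>ring_coupling\<close> at the antipode lets one formula cover all distances.\<close>

definition balanced_couplings :: "nat \<Rightarrow> (nat \<Rightarrow> real) \<Rightarrow> real \<Rightarrow> bool" where
  "balanced_couplings N b c \<longleftrightarrow>
     (\<forall>r\<in>{1..<N}. ring_coupling N b r * (sin (real r * pi / real N))\<^sup>2 = c)"

text \<open>The weight is four times the squared sine, so each ring coupling is \<open>4 * c\<close>
  over the weight and \<open>sum_mode_factor_eq_0\<close> applies.\<close>

lemma balanced_couplings_sum_eq_0:
  assumes "balanced_couplings N b c" and N: "N > 0"
    and "i > 0" "j > 0" "k > 0" "l > 0" "i + j + k + l = int N"
  shows "(\<Sum>r<N. of_real (ring_coupling N b r) * mode_factor N r (i, j, k, l)) = 0"
proof -
  have "of_real (ring_coupling N b r) = of_real (4 * c) / mode_weight N r"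
    if "r \<in> {1..<N}" for r
  proof -
    have "sin (real r * pi / real N) \<noteq> 0"
      using sin_ring_pos[of r N] that by auto
    moreover have "ring_coupling N b r * (sin (real r * pi / real N))\<^sup>2 = c"
      using assms(1) that by (simp add: balanced_couplings_def)
    ultimately have "ring_coupling N b r = 4 * c / (4 * (sin (real r * pi / real N))\<^sup>2)"
      by (simp add: field_simps)
    then show ?thesis by (simp add: mode_weight_eq)
  qed
  then have "(\<Sum>r\<in>{1..<N}. of_real (ring_coupling N b r) * mode_factor N r (i, j, k, l)) =
      of_real (4 * c) * (\<Sum>r\<in>{1..<N}. mode_factor N r (i, j, k, l) / mode_weight N r)"
    unfolding sum_distrib_left by (intro sum.cong) auto
  also have "\<dots> = 0"
    using sum_mode_factor_eq_0[OF N] assms by simp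
  finally have "(\<Sum>r\<in>{1..<N}. of_real (ring_coupling N b r) * mode_factor N r (i, j, k, l)) = 0" .
  moreover have "{..<N} = insert 0 {1..<N}" using N by auto
  ultimately show ?thesis by simp
qed

text \<open>Every tuple of \<open>S1\<close> and \<open>S2\<close> has index sum \<open>N\<close>,
  so each equation becomes a ring sum over the shifted indices. \<open>mode_system_solution\<close>
  then compares each distance with distance 1, which fixes the constant.\<close>

lemma nontrivial_solution_balanced:
  assumes N: "N > 0" "4 dvd N" and sol: "nontrivial_solution N b"
  shows "balanced_couplings N b (b 1 * (sin (pi / real N))\<^sup>2)"
proof -
  obtain K where K: "N = 4 * K" "K > 0" using N by (auto elim: dvdE)
  define M where "M = 2 * K"
  have M: "N = 2 * M" "M = 2 * K" "M > 0" using K by (auto simp: M_def)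
  have Nd: "N div 2 = M" using M by simp
  have psi0: "(\<Sum>r<N. of_real (ring_coupling N b r) *
      mode_factor N r (int M - i, int M - j, int M - k, int M - l)) = 0"
    if "(i, j, k, l) \<in> S1 N \<union> S2 N" "i + j + k + l = int N" for i j k l
  proof -
    have "\<psi> N (i, j, k, l) b = 0" using sol that(1) by (auto simp: nontrivial_solution_def)
    then show ?thesis using psi_eq_ring_sum[OF M(1,3) that(2), of b] by simp
  qed
  have "of_real (ring_coupling N b s) * mode_weight N s =
      of_real (ring_coupling N b 1) * mode_weight N 1" if "s \<in> {1..<N}" for s
  proof (rule mode_system_solution[OF M(1,2) K(2)])
    fix r assume "r < N"
    then show "complex_of_real (ring_coupling N b (N - r)) = of_real (ring_coupling N b r)"
      by (simp add: ring_coupling_reflect)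
  next
    fix n assume n: "1 \<le> n" "n \<le> int K - 1"
    then have "(0, n + 1, int M - n, int M - 1) \<in> S1 N"
      using K Nd by (auto simp: S1_def)
    then show "(\<Sum>r<N. of_real (ring_coupling N b r) *
        mode_factor N r (int M, int M - n - 1, n, 1)) = 0"
      using psi0[of 0 "n + 1" "int M - n" "int M - 1"] M by (simp add: algebra_simps)
  next
    fix m assume m: "m = 1 \<or> 3 \<le> m \<and> m \<le> int K + 1"
    then have "(2 - m, m, int M - 1, int M - 1) \<in> S2 N"
      using K Nd by (auto simp: S2_def)
    then show "(\<Sum>r<N. of_real (ring_coupling N b r) *
        mode_factor N r (int M + m - 2, int M - m, 1, 1)) = 0"
      using psi0[of "2 - m" m "int M - 1" "int M - 1"] M by (simp add: algebra_simps)
  qed (use that K in auto)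
  then have "ring_coupling N b s * (4 * (sin (real s * pi / real N))\<^sup>2) =
      ring_coupling N b 1 * (4 * (sin (real 1 * pi / real N))\<^sup>2)" if "s \<in> {1..<N}" for s
    using that unfolding mode_weight_eq of_real_mult[symmetric] of_real_eq_iff by blast
  moreover have "ring_coupling N b 1 = b 1"
    using K by (simp add: ring_coupling_def)
  ultimately show ?thesis
    by (simp add: balanced_couplings_def)
qed

text \<open>At the antipode the sine is 1 and the ring value is \<open>2 * b M\<close>, hence the
  halved coefficient there.\<close>

lemma balanced_couplings_values:
  assumes "N = 2 * M" "M > 0" and "balanced_couplings N b c"
  shows "\<And>r. r \<in> {1..<M} \<Longrightarrow> b r = c / (sin (real r * pi / real N))\<^sup>2"
    and "b M = c / 2"
proof -
  fix r assume r: "r \<in> {1..<M}"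
  then have "b r * (sin (real r * pi / real N))\<^sup>2 = c"
    using assms by (auto simp: balanced_couplings_def ring_coupling_def)
  moreover have "sin (real r * pi / real N) \<noteq> 0"
    using sin_ring_pos[of r N] r assms by auto
  ultimately show "b r = c / (sin (real r * pi / real N))\<^sup>2" by (simp add: field_simps)
next
  have "M \<in> {1..<N}" and "real M * pi / real N = pi / 2"
    using assms(1,2) by auto
  then have "ring_coupling N b M * (sin (pi / 2))\<^sup>2 = c"
    using assms(3) by (metis balanced_couplings_def)
  then show "b M = c / 2" using assms(1) by (simp add: ring_coupling_def)
qed

text \<open>All components are multiples of \<open>b 1\<close>, so \<open>b 1 = 0\<close> would make
  the whole solution trivial.\<close>

lemma nontrivial_solution_first_nonzero:
  assumes N: "N > 0" "4 dvd N" and sol: "nontrivial_solution N b"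
  shows "b 1 \<noteq> 0"
proof
  assume "b 1 = 0"
  then have bal: "balanced_couplings N b 0"
    using nontrivial_solution_balanced[OF assms] by simp
  define M where "M = N div 2"
  have M: "N = 2 * M" "M > 0" using N by (auto simp: M_def elim: dvdE)
  have "b r = 0" if "r \<in> {1..N div 2}" for r
    using balanced_couplings_values[OF M bal] that M by (cases "r = M") auto
  then show False using sol by (auto simp: nontrivial_solution_def)
qed

lemma exists_nontrivial_solution:
  assumes N: "N > 0" "4 dvd N" and c: "c \<noteq> 0"
  shows "\<exists>b. nontrivial_solution N b \<and> b 1 = c"
proof -
  obtain K where K: "N = 4 * K" "K > 0" using N by (auto elim: dvdE)
  define M where "M = 2 * K"
  have M: "N = 2 * M" "M = 2 * K" "M > 0" using K by (auto simp: M_def)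
  have Nd: "N div 2 = M" and Nd': "int N div 2 = int M" using M by simp_all
  define C where "C = c * (sin (pi / real N))\<^sup>2"
  \<comment> \<open>The factor one half at \<open>r = M\<close> undoes the doubling in
    \<open>ring_coupling\<close>.\<close>
  define b where
    "b r = C / (sin (real r * pi / real N))\<^sup>2 * (if r = M then 1 / 2 else 1)" for r
  have bal: "balanced_couplings N b C"
    unfolding balanced_couplings_def
  proof
    fix r assume r: "r \<in> {1..<N}"
    have "(sin (real r * pi / real N))\<^sup>2 > 0"
      using sin_ring_pos[of r N] r by simp
    moreover have "sin (real (N - r) * pi / real N) = sin (real r * pi / real N)"
    proof -
      have "real (N - r) * pi / real N = pi - real r * pi / real N"
        using r by (simp add: of_nat_diff field_simps)
      then show ?thesis by (simp only: sin_pi_minus)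
    qed
    ultimately show "ring_coupling N b r * (sin (real r * pi / real N))\<^sup>2 = C"
      using r M by (auto simp: ring_coupling_def b_def)
  qed
  \<comment> \<open>Distance 1 is not the antipode because \<open>N \<ge> 4\<close>, so
    \<open>b 1\<close> escapes the halving.\<close>
  have "M \<noteq> 1" using M by simp
  have "b 1 = c"
    using sin_ring_pos[of 1 N] K \<open>M \<noteq> 1\<close> by (simp add: b_def C_def)
  \<comment> \<open>This covers more than the tuples of \<open>S1\<close> and \<open>S2\<close>: the
    shifted indices are positive and have sum \<open>4 * M - N = N\<close>, which is all that the
    vanishing of the ring sum asks for.\<close>
  have solves: "\<psi> N (i, j, k, l) b = 0"
    if "i + j + k + l = int N" "i < int M" "j < int M" "k < int M" "l < int M" for i j k l
    using balanced_couplings_sum_eq_0[OF bal N(1), of "int M - i" "int M - j" "int M - k" "int M - l"]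
      psi_eq_ring_sum[OF M(1,3) that(1), of b] that M by simp
  have "\<psi> N x b = 0" if "x \<in> S1 N \<union> S2 N" for x
    using that unfolding S1_def S2_def Nd'
  proof (elim UnE CollectE exE conjE)
    fix n assume x: "x = (0, n + 1, int M - n, int M - 1)" "1 \<le> n" "n \<le> int N div 4 - 1"
    show ?thesis unfolding x(1) by (rule solves) (use x K M in auto)
  next
    fix m assume x: "x = (2 - m, m, int M - 1, int M - 1)"
      "m = 1 \<or> 3 \<le> m \<and> m \<le> int N div 4 + 1"
    show ?thesis unfolding x(1) by (rule solves) (use x K M in auto)
  qed
  then have "nontrivial_solution N b"
    using \<open>b 1 = c\<close> c M Nd by (auto simp: nontrivial_solution_def intro!: bexI[of _ 1])
  with \<open>b 1 = c\<close> show ?thesis by blast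
qed

section \<open>Rotation invariance of the reduced potential\<close>

definition site :: "nat \<Rightarrow> nat \<Rightarrow> nat" where
  "site N n = (n - 1) mod N + 1"

lemma site_mem: "N > 0 \<Longrightarrow> site N n \<in> {1..N}"
  by (simp add: site_def Suc_le_eq)

text \<open>One formula over any commutative ring: with \<open>mconst\<close> it is the polynomial,
  with \<open>id\<close> its real values, with \<open>of_real\<close> its values at complex normal
  modes.\<close>

definition lattice_potential ::
  "nat \<Rightarrow> (real \<Rightarrow> 'a::comm_ring_1) \<Rightarrow> real \<Rightarrow> real \<Rightarrow> (nat \<Rightarrow> real) \<Rightarrow> (nat \<Rightarrow> 'a) \<Rightarrow> 'a" where
  "lattice_potential N h \<mu>0 \<mu>1 b x =
     (\<Sum>n=1..N. h (\<mu>0 / 2) * x n ^ 2 + h (\<mu>1 / 2) * (x (site N (n + 1)) - x n) ^ 2) +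
     (\<Sum>n=1..N. \<Sum>r=1..N div 2. h (b r / 4) * (x (site N (n + r)) - x n) ^ 4)"

definition potential_poly ::
  "nat \<Rightarrow> real \<Rightarrow> real \<Rightarrow> (nat \<Rightarrow> real) \<Rightarrow> (nat, real) mpoly" where
  "potential_poly N \<mu>0 \<mu>1 b = lattice_potential N mconst \<mu>0 \<mu>1 b mvar"

lemma meval_diff:
  fixes h :: "'a::comm_ring_1 \<Rightarrow> 'b::comm_ring_1"
  assumes "semiring_hom h"
  shows "meval h x (P - Q) = meval h x P - meval h x Q"
proof -
  interpret semiring_hom h by fact
  have "meval h x (P - Q) + meval h x Q = meval h x P"
    by (simp flip: meval_add)
  then show ?thesis by (simp add: eq_diff_eq)
qed

lemma meval_potential_poly:
  assumes "semiring_hom h"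
  shows "meval h x (potential_poly N \<mu>0 \<mu>1 b) = lattice_potential N h \<mu>0 \<mu>1 b x"
proof -
  interpret semiring_hom h by fact
  interpret meval: semiring_hom "meval h x" by (rule semiring_hom_meval)
  show ?thesis
    by (simp add: potential_poly_def lattice_potential_def meval.hom_add meval.hom_sum
        meval.hom_mult meval.hom_power meval_diff[OF assms] meval_mconst meval_mvar)
qed

text \<open>The polynomials in the variables \<open>1..N\<close> are closed under the ring
  operations, and every \<open>site\<close> lies in this range.\<close>

lemma mvars_potential_poly:
  assumes "N > 0"
  shows "mvars (potential_poly N \<mu>0 \<mu>1 b) \<subseteq> {1..N}"
proof -
  define A where "A = {P :: (nat, real) mpoly. mvars P \<subseteq> {1..N}}"
  have var: "mvar n \<in> A" if "n \<in> {1..N}" for n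
    using that by (simp add: A_def)
  have const: "mconst c \<in> A" for c
    by (simp add: A_def)
  have add: "P + Q \<in> A" and diff: "P - Q \<in> A" and mult: "P * Q \<in> A"
    if "P \<in> A" "Q \<in> A" for P Q
    using that mvars_add[of P Q] mvars_diff[of P Q] mvars_mult[of P Q] by (auto simp: A_def)
  have power: "P ^ n \<in> A" if "P \<in> A" for P n
    using that mvars_power[of P n] by (auto simp: A_def)
  have sum: "sum f I \<in> A" if "\<And>i. i \<in> I \<Longrightarrow> f i \<in> A" for f and I :: "nat set"
    using that mvars_sum[of f I] unfolding A_def by blast
  have "potential_poly N \<mu>0 \<mu>1 b \<in> A"
    unfolding potential_poly_def lattice_potential_def
    by (intro add sum mult const power diff var site_mem assms)
  then show ?thesis by (simp add: A_def)
qed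

lemma quartic_hamiltonian_natural:
  "quartic_hamiltonian N \<mu>0 \<mu>1 b = natural_hamiltonian N (potential_poly N \<mu>0 \<mu>1 b)"
proof (intro ext)
  fix q p
  show "quartic_hamiltonian N \<mu>0 \<mu>1 b q p =
      natural_hamiltonian N (potential_poly N \<mu>0 \<mu>1 b) q p"
    by (simp add: quartic_hamiltonian_def natural_hamiltonian_def
        meval_potential_poly[OF semiring_hom_id] lattice_potential_def periodic_def site_def
        sum_distrib_left mult_ac)
qed

section \<open>Normal mode coordinates without the mode \<open>N/2\<close>\<close>

definition mode_range :: "nat \<Rightarrow> int set" where
  "mode_range N = {- int (N div 2) + 1 .. int (N div 2) - 1}"

text \<open>The sign \<open>(-1)^n\<close> is \<open>\<omega>^(n N/2)\<close> for even
  \<open>N\<close>, so it merges with the exponential into a root with the shifted index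
  \<open>N/2 - m\<close>.\<close>

definition mode_coordinate :: "nat \<Rightarrow> (int \<Rightarrow> complex) \<Rightarrow> nat \<Rightarrow> complex" where
  "mode_coordinate N U n =
     (\<Sum>m\<in>mode_range N. unity_root N (int n * (int (N div 2) - m)) * U m) / of_real (sqrt N)"

lemma meval_mode_expansion:
  assumes "even N" "N > 0"
  shows "meval id (U(int (N div 2) := 0)) (mode_expansion N n) = mode_coordinate N U n"
proof -
  obtain M where M: "N = 2 * M" using assms(1) ..
  have MN: "N div 2 = M" "M > 0" using M assms by auto
  interpret meval: semiring_hom "meval id (U(int M := 0))"
    by (intro semiring_hom.semiring_hom_meval semiring_hom_id)
  have set: "{- int M + 1 .. int M} = insert (int M) (mode_range N)"
    using MN by (auto simp: mode_range_def)
  have root: "(-1) ^ n * exp (- \<i> * of_real (2 * pi * real n / real N * real_of_int m)) =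
      unity_root N (int n * (int M - m))" for m
  proof -
    have "(-1) ^ n * exp (- \<i> * of_real (2 * pi * real n / real N * real_of_int m)) =
        cis (real n * pi) * cis (- (2 * pi * real n / real N * real_of_int m))"
      using Complex.DeMoivre[of pi n] by (simp add: cis_conv_exp)
    also have "\<dots> = cis (real n * pi - 2 * pi * real n / real N * real_of_int m)"
      by (simp add: cis_mult)
    also have "real n * pi - 2 * pi * real n / real N * real_of_int m =
        2 * pi * of_int (int n * (int M - m)) / real N"
      using M MN by (simp add: field_simps)
    finally show ?thesis by (simp add: unity_root_def)
  qed
  have "meval id (U(int (N div 2) := 0)) (mode_expansion N n) =
      (-1) ^ n / of_real (sqrt N) * (\<Sum>m\<in>mode_range N.
        exp (- \<i> * of_real (2 * pi * real n / real N * real_of_int m)) * U m)"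
    unfolding mode_expansion_def MN set
    by (simp add: meval.hom_add meval.hom_mult meval.hom_sum semiring_hom.meval_mconst[OF semiring_hom_id]
        semiring_hom.meval_mvar[OF semiring_hom_id] MN mode_range_def)
  also have "\<dots> = mode_coordinate N U n"
    unfolding mode_coordinate_def MN root[symmetric]
    by (simp add: sum_distrib_left sum_divide_distrib mult_ac)
  finally show ?thesis .
qed

text \<open>Roots of unity depend on the exponent modulo \<open>N\<close> only, so the periodic wrap
  is harmless and a shift by \<open>r\<close> multiplies each mode by its own root.\<close>

lemma mode_coordinate_site_diff:
  assumes "N > 0" and "n > 0"
  shows "mode_coordinate N U (site N (n + r)) - mode_coordinate N U n =
    (\<Sum>m\<in>mode_range N. unity_root N (int n * (int (N div 2) - m)) *
      (unity_root N (int r * (int (N div 2) - m)) - 1) * U m) / of_real (sqrt N)"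
proof -
  have "int N dvd int (site N (n + r)) - int (n + r)"
  proof -
    have "int (n + r - 1) mod int N - int (n + r - 1) = - (int N * (int (n + r - 1) div int N))"
      by (simp add: minus_div_mult_eq_mod[symmetric])
    moreover have "int (site N (n + r)) - int (n + r) =
        int (n + r - 1) mod int N - int (n + r - 1)"
      using assms by (simp add: site_def zmod_int of_nat_diff)
    ultimately show ?thesis by simp
  qed
  then have "int N dvd int (site N (n + r)) * k - int (n + r) * k" for k
    unfolding left_diff_distrib[symmetric] by (rule dvd_mult2)
  from unity_root_cong[OF assms(1) this]
  have "unity_root N (int (site N (n + r)) * k) =
      unity_root N (int n * k) * unity_root N (int r * k)" for k
    by (simp add: distrib_right unity_root_add)
  moreover have "a * b * u - a * u = a * (b - 1) * u" for a b u :: complex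
    by (simp add: algebra_simps)
  ultimately show ?thesis
    unfolding mode_coordinate_def diff_divide_distrib[symmetric] sum_subtractf[symmetric]
    by (simp only:)
qed

section \<open>Rotation invariance of the quadratic and quartic sums\<close>

lemma mode_rotation_cis: "mode_rotation \<theta> U m = U m * cis (- (of_int m * \<theta>))"
  by (simp add: mode_rotation_def cis_conv_exp mult_ac)

lemma sum_power2_product:
  fixes g :: "'b \<Rightarrow> 'a::comm_semiring_1"
  shows "sum g J ^ 2 = (\<Sum>(i, j)\<in>J \<times> J. g i * g j)"
  by (simp add: power2_eq_square sum_product sum.cartesian_product)

lemma sum_power4_product:
  fixes g :: "'b \<Rightarrow> 'a::comm_semiring_1"
  shows "sum g J ^ 4 = (\<Sum>(i, j, k, l)\<in>J \<times> J \<times> J \<times> J. g i * g j * g k * g l)"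
  unfolding sum.cartesian_product[symmetric]
  by (simp add: power4_eq_xxxx flip: sum_distrib_left sum_distrib_right)

text \<open>Summation over the sites keeps only pairs with \<open>i + j\<close> divisible by
  \<open>N\<close>. Since \<open>\<bar>i + j\<bar> < N\<close>, this means \<open>i + j = 0\<close>,
  where the rotation phases cancel. The free weights \<open>d\<close> serve the on-site and the
  nearest-neighbour terms at once.\<close>

lemma quadratic_rotation_invariant:
  assumes N: "N > 0" "even N"
  shows "(\<Sum>n=1..N. (\<Sum>m\<in>mode_range N.
      unity_root N (int n * (int (N div 2) - m)) * d m * mode_rotation \<theta> U m) ^ 2) =
    (\<Sum>n=1..N. (\<Sum>m\<in>mode_range N.
      unity_root N (int n * (int (N div 2) - m)) * d m * U m) ^ 2)"
proof -
  obtain M where M: "N = 2 * M" using N(2) ..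
  have MN: "N div 2 = M" "M > 0" using M N by auto
  let ?J = "mode_range N"
  have expand: "(\<Sum>n=1..N. (\<Sum>m\<in>?J. unity_root N (int n * (int (N div 2) - m)) * d m * V m) ^ 2) =
      (\<Sum>(i, j)\<in>?J \<times> ?J. (\<Sum>n=1..N. unity_root N (int n * (int N - (i + j)))) *
        (d i * d j * (V i * V j)))" for V
  proof -
    have "(\<Sum>n=1..N. (\<Sum>m\<in>?J. unity_root N (int n * (int M - m)) * d m * V m) ^ 2) =
        (\<Sum>(i, j)\<in>?J \<times> ?J. \<Sum>n=1..N. unity_root N (int n * (int M - i)) * d i * V i *
          (unity_root N (int n * (int M - j)) * d j * V j))"
      unfolding sum_power2_product by (subst sum.swap) (simp add: case_prod_unfold)
    also have "\<dots> = (\<Sum>(i, j)\<in>?J \<times> ?J. (\<Sum>n=1..N. unity_root N (int n * (int N - (i + j)))) *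
        (d i * d j * (V i * V j)))"
    proof (intro sum.cong refl, clarify)
      fix i j
      have "unity_root N (int n * (int N - (i + j))) =
          unity_root N (int n * (int M - i)) * unity_root N (int n * (int M - j))" for n
        by (simp add: M algebra_simps flip: unity_root_add)
      then show "(\<Sum>n=1..N. unity_root N (int n * (int M - i)) * d i * V i *
          (unity_root N (int n * (int M - j)) * d j * V j)) =
        (\<Sum>n=1..N. unity_root N (int n * (int N - (i + j)))) * (d i * d j * (V i * V j))"
        by (simp add: sum_distrib_left sum_distrib_right mult_ac)
    qed
    finally show ?thesis unfolding MN .
  qed
  show ?thesis
    unfolding expand
  proof (intro sum.cong refl, clarify)
    fix i j assume ij: "i \<in> ?J" "j \<in> ?J"
    show "(\<Sum>n=1..N. unity_root N (int n * (int N - (i + j)))) *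
        (d i * d j * (mode_rotation \<theta> U i * mode_rotation \<theta> U j)) =
      (\<Sum>n=1..N. unity_root N (int n * (int N - (i + j)))) * (d i * d j * (U i * U j))"
    proof (cases "i + j = 0")
      case True
      then have "j = - i" by simp
      have "cis (- (of_int i * \<theta>)) * cis (- (of_int j * \<theta>)) = 1"
        by (simp add: cis_mult \<open>j = - i\<close>)
      then have "mode_rotation \<theta> U i * mode_rotation \<theta> U j = U i * U j"
        by (simp add: mode_rotation_cis mult_ac)
      then show ?thesis by simp
    next
      case False
      have "\<bar>i + j\<bar> < int N" using ij M MN by (auto simp: mode_range_def)
      then have "\<not> int N dvd i + j"
        using False dvd_imp_le_int[of "i + j" "int N"] by auto
      then have "\<not> int N dvd int N - (i + j)"
        using dvd_diff_right_iff[of "int N" "int N" "i + j"] by auto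
      then have "(\<Sum>n=1..N. unity_root N (int n * (int N - (i + j)))) = 0"
        by (simp only: sum_unity_root_power'[OF N(1)] if_False)
      then show ?thesis by (simp only: mult_zero_left)
    qed
  qed
qed

text \<open>Index sum \<open>N\<close> is the vanishing ring sum, folded to half the distances.
  Index sum \<open>3 * N\<close> reduces to it by complementing every index to \<open>N\<close>,
  which has the effect of \<open>r -> N - r\<close> and so preserves
  \<open>mode_factor\<close>.\<close>

lemma balanced_couplings_cancel:
  assumes bal: "balanced_couplings N b c" and N: "N = 2 * M" "M > 0"
    and range: "0 < i" "0 < j" "0 < k" "0 < l" "i < int N" "j < int N" "k < int N" "l < int N"
    and sum: "i + j + k + l = int N \<or> i + j + k + l = 3 * int N"
  shows "(\<Sum>r=1..M. of_real (b r) * mode_factor N r (i, j, k, l)) = 0"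
proof -
  have N0: "N > 0" using N by simp
  have *: "(\<Sum>r=1..M. of_real (b r) * mode_factor N r (i, j, k, l)) = 0"
    if "i > 0" "j > 0" "k > 0" "l > 0" "i + j + k + l = int N" for i j k l
  proof -
    have "{..<N} = insert 0 {1..<N}" using N by auto
    then have "(\<Sum>r\<in>{1..<N}. of_real (ring_coupling N b r) * mode_factor N r (i, j, k, l)) = 0"
      using balanced_couplings_sum_eq_0[OF bal N0 that] by simp
    moreover have "(\<Sum>r\<in>{1..<N}. of_real (ring_coupling N b r) * mode_factor N r (i, j, k, l)) =
        2 * (\<Sum>r=1..M. of_real (b r) * mode_factor N r (i, j, k, l))"
      using that N0 by (intro sum_ring_coupling[OF N] mode_factor_reflect) auto
    ultimately show ?thesis by simp
  qed
  show ?thesis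
  proof (cases "i + j + k + l = int N")
    case True
    then show ?thesis using * range by simp
  next
    case False
    have "mode_factor N r (i, j, k, l) = mode_factor N r (int N - i, int N - j, int N - k, int N - l)"
      if "r \<in> {1..M}" for r
    proof -
      have r: "r \<le> N" using that N by auto
      have root: "unity_root N (int (N - r) * (int N - m)) = unity_root N (int r * m)" for m
        using r by (intro unity_root_cong[OF N0]) (simp add: of_nat_diff algebra_simps)
      have "mode_factor N r (i, j, k, l) =
          mode_factor N (N - r) (int N - i, int N - j, int N - k, int N - l)"
        unfolding mode_factor_def prod.case root ..
      also have "\<dots> = mode_factor N r (int N - i, int N - j, int N - k, int N - l)"
      proof (intro mode_factor_reflect N0 r)
        have "int N - i + (int N - j) + (int N - k) + (int N - l) = int N"
          using sum False by simp
        then show "int N dvd int N - i + (int N - j) + (int N - k) + (int N - l)"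
          by (simp only: dvd_refl)
      qed
      finally show ?thesis .
    qed
    moreover have "(\<Sum>r=1..M. of_real (b r) *
        mode_factor N r (int N - i, int N - j, int N - k, int N - l)) = 0"
      using sum False range by (intro *) auto
    ultimately show ?thesis by simp
  qed
qed

text \<open>In degree four the mode sum satisfies only \<open>\<bar>S\<bar> < 2 * N\<close>, so
  besides \<open>S = 0\<close> also \<open>S = N\<close> and \<open>S = - N\<close> survive the
  summation over the sites. The shifted indices then have sum \<open>N\<close> or
  \<open>3 * N\<close>, and the balance of the couplings annihilates the coefficient.\<close>

lemma quartic_rotation_invariant:
  assumes N: "N > 0" "even N" and bal: "balanced_couplings N b c"
  shows "(\<Sum>n=1..N. \<Sum>r=1..N div 2. of_real (b r) * (\<Sum>m\<in>mode_range N.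
      unity_root N (int n * (int (N div 2) - m)) * (unity_root N (int r * (int (N div 2) - m)) - 1) *
      mode_rotation \<theta> U m) ^ 4) =
    (\<Sum>n=1..N. \<Sum>r=1..N div 2. of_real (b r) * (\<Sum>m\<in>mode_range N.
      unity_root N (int n * (int (N div 2) - m)) * (unity_root N (int r * (int (N div 2) - m)) - 1) *
      U m) ^ 4)"
proof -
  obtain M where M: "N = 2 * M" using N(2) ..
  have MN: "N div 2 = M" "M > 0" using M N by auto
  let ?J = "mode_range N"
  define F where "F r i j k l = mode_factor N r (int M - i, int M - j, int M - k, int M - l)"
    for r i j k l
  have expand: "(\<Sum>n=1..N. \<Sum>r=1..M. of_real (b r) * (\<Sum>m\<in>?J.
      unity_root N (int n * (int M - m)) * (unity_root N (int r * (int M - m)) - 1) * V m) ^ 4) =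
      (\<Sum>(i, j, k, l)\<in>?J \<times> ?J \<times> ?J \<times> ?J.
        (\<Sum>n=1..N. unity_root N (int n * (2 * int N - (i + j + k + l)))) *
        (\<Sum>r=1..M. of_real (b r) * F r i j k l) * (V i * V j * V k * V l))" for V
  proof -
    define g where "g n r m =
      unity_root N (int n * (int M - m)) * (unity_root N (int r * (int M - m)) - 1) * V m" for n r m
    have "(\<Sum>n=1..N. \<Sum>r=1..M. of_real (b r) * sum (g n r) ?J ^ 4) =
        (\<Sum>(n, r)\<in>{1..N} \<times> {1..M}. \<Sum>(i, j, k, l)\<in>?J \<times> ?J \<times> ?J \<times> ?J.
          of_real (b r) * (g n r i * g n r j * g n r k * g n r l))"
      by (subst sum.cartesian_product)
         (simp add: sum_power4_product sum_distrib_left case_prod_unfold)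
    also have "\<dots> = (\<Sum>(i, j, k, l)\<in>?J \<times> ?J \<times> ?J \<times> ?J. \<Sum>(n, r)\<in>{1..N} \<times> {1..M}.
          of_real (b r) * (g n r i * g n r j * g n r k * g n r l))"
      unfolding case_prod_unfold by (rule sum.swap)
    also have "\<dots> = (\<Sum>(i, j, k, l)\<in>?J \<times> ?J \<times> ?J \<times> ?J.
        (\<Sum>n=1..N. unity_root N (int n * (2 * int N - (i + j + k + l)))) *
        (\<Sum>r=1..M. of_real (b r) * F r i j k l) * (V i * V j * V k * V l))"
    proof (intro sum.cong refl, clarify)
      fix i j k l
      have "unity_root N (int n * (2 * int N - (i + j + k + l))) =
          unity_root N (int n * (int M - i)) * unity_root N (int n * (int M - j)) *
          unity_root N (int n * (int M - k)) * unity_root N (int n * (int M - l))" for n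
        by (simp add: M algebra_simps flip: unity_root_add)
      then show "(\<Sum>(n, r)\<in>{1..N} \<times> {1..M}.
            of_real (b r) * (g n r i * g n r j * g n r k * g n r l)) =
          (\<Sum>n=1..N. unity_root N (int n * (2 * int N - (i + j + k + l)))) *
          (\<Sum>r=1..M. of_real (b r) * F r i j k l) * (V i * V j * V k * V l)"
        unfolding sum_product unfolding sum.cartesian_product unfolding sum_distrib_right
        by (intro sum.cong refl) (simp add: g_def F_def mode_factor_def mult_ac case_prod_unfold)
    qed
    finally show ?thesis unfolding g_def .
  qed
  show ?thesis
    unfolding MN expand
  proof (intro sum.cong refl, clarify)
    fix i j k l assume J: "i \<in> ?J" "j \<in> ?J" "k \<in> ?J" "l \<in> ?J"
    let ?S = "i + j + k + l"
    consider "?S = 0" | "\<not> int N dvd 2 * int N - ?S" | "?S = int N \<or> ?S = - int N"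
    proof (cases "int N dvd 2 * int N - ?S")
      case True
      have "int N dvd 2 * int N - (2 * int N - ?S)"
        by (rule dvd_diff[OF _ True]) simp
      also have "2 * int N - (2 * int N - ?S) = ?S" by simp
      finally obtain q where q: "?S = int N * q" by (rule dvdE)
      have "\<bar>?S\<bar> < int N * 2" using J M MN by (auto simp: mode_range_def)
      then have "\<bar>q\<bar> < 2"
        using N(1) unfolding q abs_mult by simp
      then have "q = 0 \<or> q = 1 \<or> q = -1" by linarith
      then show ?thesis using q that by auto
    qed (use that in auto)
    then show "(\<Sum>n=1..N. unity_root N (int n * (2 * int N - ?S))) *
        (\<Sum>r=1..M. of_real (b r) * F r i j k l) *
        (mode_rotation \<theta> U i * mode_rotation \<theta> U j * mode_rotation \<theta> U k * mode_rotation \<theta> U l) =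
      (\<Sum>n=1..N. unity_root N (int n * (2 * int N - ?S))) *
        (\<Sum>r=1..M. of_real (b r) * F r i j k l) * (U i * U j * U k * U l)"
    proof cases
      case 1
      have "cis (- (of_int i * \<theta>)) * cis (- (of_int j * \<theta>)) * cis (- (of_int k * \<theta>)) *
          cis (- (of_int l * \<theta>)) = cis (- (of_int ?S * \<theta>))"
        by (simp add: cis_mult algebra_simps)
      also have "\<dots> = 1" unfolding 1 by simp
      finally have "cis (- (of_int i * \<theta>)) * cis (- (of_int j * \<theta>)) * cis (- (of_int k * \<theta>)) *
          cis (- (of_int l * \<theta>)) = 1" .
      then have "mode_rotation \<theta> U i * mode_rotation \<theta> U j * mode_rotation \<theta> U k *
          mode_rotation \<theta> U l = U i * U j * U k * U l"
        by (simp add: mode_rotation_cis mult_ac)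
      then show ?thesis by simp
    next
      case 2
      then have "(\<Sum>n=1..N. unity_root N (int n * (2 * int N - ?S))) = 0"
        by (simp only: sum_unity_root_power'[OF N(1)] if_False)
      then show ?thesis by (simp only: mult_zero_left)
    next
      case 3
      have "(\<Sum>r=1..M. of_real (b r) * F r i j k l) = 0"
        unfolding F_def using J M MN 3
        by (intro balanced_couplings_cancel[OF bal M]) (auto simp: mode_range_def)
      then show ?thesis by simp
    qed
  qed
qed

lemma lattice_potential_rotation_invariant:
  assumes N: "N > 0" "even N" and bal: "balanced_couplings N b c"
  shows "lattice_potential N of_real \<mu>0 \<mu>1 b (mode_coordinate N (mode_rotation \<theta> U)) =
    (lattice_potential N of_real \<mu>0 \<mu>1 b (mode_coordinate N U) :: complex)"
proof -
  let ?J = "mode_range N" and ?w = "\<lambda>n m. unity_root N (int n * (int (N div 2) - m))"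
  \<comment> \<open>Powers of \<open>sqrt N\<close> are pulled out so that all three sums take the
    form of the preceding lemmas, with \<open>d m = 1\<close> on site and
    \<open>d m = \<omega>^(N/2 - m) - 1\<close> for nearest neighbours.\<close>
  have expand: "lattice_potential N of_real \<mu>0 \<mu>1 b (mode_coordinate N V) =
      of_real (\<mu>0 / 2) / of_real (sqrt N) ^ 2 * (\<Sum>n=1..N. (\<Sum>m\<in>?J. ?w n m * 1 * V m) ^ 2) +
      of_real (\<mu>1 / 2) / of_real (sqrt N) ^ 2 *
        (\<Sum>n=1..N. (\<Sum>m\<in>?J. ?w n m * (?w 1 m - 1) * V m) ^ 2) +
      1 / (4 * of_real (sqrt N) ^ 4) * (\<Sum>n=1..N. \<Sum>r=1..N div 2. of_real (b r) *
        (\<Sum>m\<in>?J. ?w n m * (?w r m - 1) * V m) ^ 4)" for V :: "int \<Rightarrow> complex"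
  proof -
    have "lattice_potential N of_real \<mu>0 \<mu>1 b (mode_coordinate N V) =
      (\<Sum>n=1..N. of_real (\<mu>0 / 2) * ((\<Sum>m\<in>?J. ?w n m * 1 * V m) / of_real (sqrt N)) ^ 2 +
        of_real (\<mu>1 / 2) * ((\<Sum>m\<in>?J. ?w n m * (?w 1 m - 1) * V m) / of_real (sqrt N)) ^ 2) +
      (\<Sum>n=1..N. \<Sum>r=1..N div 2. of_real (b r / 4) *
        ((\<Sum>m\<in>?J. ?w n m * (?w r m - 1) * V m) / of_real (sqrt N)) ^ 4)"
      unfolding lattice_potential_def
      by (intro arg_cong2[where f = "(+)"] sum.cong refl)
         (simp_all add: mode_coordinate_site_diff[OF N(1)]
           mode_coordinate_site_diff[OF N(1), where r = 1, simplified],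
          simp add: mode_coordinate_def)
    then show ?thesis
      by (simp add: sum.distrib sum_distrib_left power_divide)
  qed
  show ?thesis
    unfolding expand quadratic_rotation_invariant[OF N] quartic_rotation_invariant[OF N bal] ..
qed

section \<open>Monomial weights and averaging over rotations\<close>

definition monom_weight :: "(int \<Rightarrow>\<^sub>0 nat) \<Rightarrow> int" where
  "monom_weight e = (\<Sum>v\<in>Poly_Mapping.keys e. v * int (Poly_Mapping.lookup e v))"

lemma monom_eval_mode_rotation:
  "monom_eval (mode_rotation \<theta> U) e = monom_eval U e * cis (- (of_int (monom_weight e) * \<theta>))"
proof -
  have "(\<Prod>v\<in>A. cis (- (of_int v * \<theta>)) ^ k v) = cis (- (of_int (\<Sum>v\<in>A. v * int (k v)) * \<theta>))"
    for A :: "int set" and k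
    by (induction A rule: infinite_finite_induct)
       (simp_all add: Complex.DeMoivre cis_mult algebra_simps)
  then show ?thesis
    by (simp add: monom_eval_def mode_rotation_cis power_mult_distrib prod.distrib monom_weight_def)
qed

lemma invariant_monom_if_weight_0: "monom_weight e = 0 \<Longrightarrow> invariant_monom e"
  by (simp add: invariant_monom_def monom_eval_mode_rotation)

text \<open>Averaging over the rotations by multiples of \<open>2\<pi>/L\<close>, with \<open>L\<close> larger than all weights, kills
  exactly the monomials that are not invariant.\<close>

lemma rotation_invariant_eq_invariant_part:
  fixes R :: "(int, complex) mpoly"
  assumes inv: "\<And>\<theta> U. meval id (mode_rotation \<theta> U) R = meval id U R"
  shows "meval id U (\<Sum>e | e \<in> Poly_Mapping.keys R \<and> invariant_monom e.
    Poly_Mapping.single e (Poly_Mapping.lookup R e)) = meval id U R"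
proof -
  let ?K = "Poly_Mapping.keys R"
  define L where "L = Suc (nat (\<Sum>e\<in>?K. \<bar>monom_weight e\<bar>))"
  have "L \<noteq> 0" by (simp add: L_def)
  define \<theta> where "\<theta> k = 2 * pi * real k / real L" for k
  have avg: "(\<Sum>k<L. monom_eval (mode_rotation (\<theta> k) U) e) =
      (if invariant_monom e then of_nat L * monom_eval U e else 0)" if "e \<in> ?K" for e
  proof (cases "invariant_monom e")
    case True
    then show ?thesis by (simp add: invariant_monom_def)
  next
    case False
    then have "monom_weight e \<noteq> 0" using invariant_monom_if_weight_0 by blast
    moreover have "\<bar>monom_weight e\<bar> < int L"
    proof -
      have "\<bar>monom_weight e\<bar> \<le> (\<Sum>e\<in>?K. \<bar>monom_weight e\<bar>)"
        by (rule member_le_sum[OF that]) auto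
      then show ?thesis by (simp add: L_def)
    qed
    ultimately have "\<not> int L dvd - monom_weight e"
      using dvd_imp_le_int[of "monom_weight e" "int L"] by auto
    moreover have "monom_eval (mode_rotation (\<theta> k) U) e =
        monom_eval U e * unity_root L (int k * - monom_weight e)" for k
      by (simp add: monom_eval_mode_rotation unity_root_def \<theta>_def mult_ac)
    ultimately have "(\<Sum>k<L. monom_eval (mode_rotation (\<theta> k) U) e) = 0"
      using sum_unity_root_power[of L "- monom_weight e"]
      by (simp add: L_def flip: sum_distrib_left)
    then show ?thesis using False by simp
  qed
  \<comment> \<open>By assumption all \<open>L\<close> rotated values agree, so their average is the
    value itself; term by term it retains the invariant monomials only.\<close>
  have "of_nat L * meval id U R = (\<Sum>k<L. meval id (mode_rotation (\<theta> k) U) R)"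
    by (simp add: inv)
  also have "\<dots> = (\<Sum>e\<in>?K. Poly_Mapping.lookup R e *
      (\<Sum>k<L. monom_eval (mode_rotation (\<theta> k) U) e))"
    unfolding meval_def by (subst sum.swap) (simp add: sum_distrib_left)
  also have "\<dots> = (\<Sum>e\<in>?K. if invariant_monom e
      then of_nat L * (Poly_Mapping.lookup R e * monom_eval U e) else 0)"
    by (intro sum.cong refl) (simp add: avg)
  also have "\<dots> = of_nat L * (\<Sum>e | e \<in> ?K \<and> invariant_monom e.
      Poly_Mapping.lookup R e * monom_eval U e)"
    by (auto simp: sum.inter_filter sum_distrib_left intro!: sum.cong)
  finally have "meval id U R = (\<Sum>e | e \<in> ?K \<and> invariant_monom e.
      Poly_Mapping.lookup R e * monom_eval U e)"
    using \<open>L \<noteq> 0\<close> by simp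
  then show ?thesis
    by (simp add: semiring_hom.meval_sum[OF semiring_hom_id]
        semiring_hom.meval_single[OF semiring_hom_id])
qed

text \<open>Substitution followed by evaluation is evaluation at the evaluated linear forms, which
  are the mode coordinates.\<close>

lemma meval_mode_potential:
  assumes "even N" "N > 0"
  shows "meval id (U(int (N div 2) := 0)) (mode_potential N (potential_poly N \<mu>0 \<mu>1 b)) =
    lattice_potential N of_real \<mu>0 \<mu>1 b (mode_coordinate N U)"
proof -
  have hom: "semiring_hom (meval id V :: (int, complex) mpoly \<Rightarrow> complex)" for V
    by (intro semiring_hom.semiring_hom_meval semiring_hom_id)
  show ?thesis
    unfolding mode_potential_def
    by (subst meval_comp[OF hom])
       (simp add: semiring_hom.meval_mconst[OF semiring_hom_id] meval_mode_expansion[OF assms]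
         meval_potential_poly[OF semiring_hom_of_real])
qed

lemma meval_reduced_potential:
  "meval id U (reduced_potential N \<Phi>) = meval id (U(int (N div 2) := 0)) (mode_potential N \<Phi>)"
proof -
  have hom: "semiring_hom (meval id V :: (int, complex) mpoly \<Rightarrow> complex)" for V
    by (intro semiring_hom.semiring_hom_meval semiring_hom_id)
  have "(\<lambda>m. meval id U (if m = int (N div 2) then 0 else mvar m)) = U(int (N div 2) := 0)"
    by (auto simp: semiring_hom.meval_mvar[OF semiring_hom_id] semiring_hom.hom_zero[OF hom])
  moreover have "(\<lambda>c. meval id U (mconst c)) = id"
    by (auto simp: semiring_hom.meval_mconst[OF semiring_hom_id])
  ultimately show ?thesis
    unfolding reduced_potential_def by (simp only: meval_comp[OF hom])
qed

text \<open>Rotation invariance has been established for values; averaging turns it into a statement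
  about monomials, so the reduced potential agrees everywhere with its symmetric part.\<close>

lemma asymmetric_potential_eq_0:
  assumes N: "N > 0" "even N" and bal: "balanced_couplings N b c"
  shows "asymmetric_potential N (potential_poly N \<mu>0 \<mu>1 b) U 0 = 0"
proof -
  have "meval id V (reduced_potential N (potential_poly N \<mu>0 \<mu>1 b)) =
      lattice_potential N of_real \<mu>0 \<mu>1 b (mode_coordinate N V)" for V
    by (simp add: meval_reduced_potential meval_mode_potential N)
  then have "meval id (mode_rotation \<theta> V) (reduced_potential N (potential_poly N \<mu>0 \<mu>1 b)) =
      meval id V (reduced_potential N (potential_poly N \<mu>0 \<mu>1 b))" for \<theta> V
    using lattice_potential_rotation_invariant[OF N bal] by simp
  from rotation_invariant_eq_invariant_part[OF this] show ?thesis
    by (simp add: asymmetric_potential_def symmetric_part_def meval_reduced_potential)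
qed

section \<open>Invariance of the zero-mean subspace\<close>

lemma deriv_quartic_hamiltonian_momentum:
  assumes "n \<in> {1..N}"
  shows "deriv (\<lambda>x. quartic_hamiltonian N \<mu>0 \<mu>1 b q (p(n := x))) (p n) = p n"
proof -
  have var: "((\<lambda>x. (p(n := x)) m) has_real_derivative of_bool (m = n)) (at x)" for m x
    by (cases "m = n") auto
  have "((\<lambda>x. quartic_hamiltonian N \<mu>0 \<mu>1 b q (p(n := x))) has_real_derivative
      (\<Sum>m=1..N. p m * of_bool (m = n))) (at (p n))"
    unfolding quartic_hamiltonian_def
    by (rule derivative_eq_intros var refl | simp)+
  moreover have "(\<Sum>m=1..N. p m * of_bool (m = n)) = (\<Sum>m=1..N. if m = n then p n else 0)"
    by (intro sum.cong) auto
  ultimately show ?thesis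
    using assms by (simp add: DERIV_imp_deriv)
qed

text \<open>The partial derivative of the potential in \<open>q n\<close>, that is, minus the force.
  All bonds are listed with Kronecker deltas instead of only those touching \<open>n\<close>, so
  that the sum over \<open>n\<close> can be taken bond by bond.\<close>

definition force_term ::
  "nat \<Rightarrow> real \<Rightarrow> real \<Rightarrow> (nat \<Rightarrow> real) \<Rightarrow> (nat \<Rightarrow> real) \<Rightarrow> nat \<Rightarrow> real" where
  "force_term N \<mu>0 \<mu>1 b q n =
     (\<Sum>m=1..N. \<mu>0 * q m * of_bool (m = n) +
       \<mu>1 * (q (site N (m + 1)) - q m) * (of_bool (site N (m + 1) = n) - of_bool (m = n))) +
     (\<Sum>m=1..N. \<Sum>r=1..N div 2. b r * (q (site N (m + r)) - q m) ^ 3 *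
       (of_bool (site N (m + r) = n) - of_bool (m = n)))"

lemma bond_energy_derivatives:
  fixes f g :: "real \<Rightarrow> real"
  assumes "(f has_real_derivative f') (at a)" and "(g has_real_derivative g') (at a)"
  shows "((\<lambda>x. c / 2 * (f x)\<^sup>2 + d / 2 * (g x - f x)\<^sup>2) has_real_derivative
      c * f a * f' + d * (g a - f a) * (g' - f')) (at a)"
    and "((\<lambda>x. c * (g x - f x) ^ 4) has_real_derivative
      4 * (c * (g a - f a) ^ 3 * (g' - f'))) (at a)"
  using assms by (auto intro!: derivative_eq_intros simp: field_simps)

lemma deriv_quartic_hamiltonian_position:
  "deriv (\<lambda>x. quartic_hamiltonian N \<mu>0 \<mu>1 b (q(n := x)) p) (q n) = force_term N \<mu>0 \<mu>1 b q n"
proof -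
  have var: "((\<lambda>x. (q(n := x)) m) has_real_derivative of_bool (m = n)) (at x)" for m x
    by (cases "m = n") auto
  \<comment> \<open>The leading 0 belongs to the kinetic energy, which is constant in
    \<open>x\<close>; \<open>q(n := q n)\<close> is the updated configuration at the base
    point.\<close>
  have "((\<lambda>x. quartic_hamiltonian N \<mu>0 \<mu>1 b (q(n := x)) p) has_real_derivative
      0 + (\<Sum>m=1..N. \<mu>0 * (q(n := q n)) m * of_bool (m = n) +
       \<mu>1 * ((q(n := q n)) (site N (m + 1)) - (q(n := q n)) m) *
         (of_bool (site N (m + 1) = n) - of_bool (m = n))) +
      1 / 4 * (\<Sum>m=1..N. \<Sum>r=1..N div 2.
        4 * (b r * ((q(n := q n)) (site N (m + r)) - (q(n := q n)) m) ^ 3 *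
       (of_bool (site N (m + r) = n) - of_bool (m = n))))) (at (q n))"
    unfolding quartic_hamiltonian_def periodic_def site_def[symmetric]
    by (rule DERIV_add, rule DERIV_add, rule DERIV_const, rule DERIV_sum,
        rule bond_energy_derivatives(1)[OF var var], rule DERIV_cmult, rule DERIV_sum, rule DERIV_sum,
        rule bond_energy_derivatives(2)[OF var var])
  then have "((\<lambda>x. quartic_hamiltonian N \<mu>0 \<mu>1 b (q(n := x)) p) has_real_derivative
      force_term N \<mu>0 \<mu>1 b q n) (at (q n))"
    unfolding fun_upd_triv force_term_def sum_distrib_left by simp
  then show ?thesis by (rule DERIV_imp_deriv)
qed

text \<open>Internal forces cancel in pairs: each bond contributes a difference of two deltas, whose
  sum over \<open>n\<close> is zero. Only the on-site terms remain.\<close>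

lemma sum_force_term:
  assumes "N > 0"
  shows "(\<Sum>n=1..N. force_term N \<mu>0 \<mu>1 b q n) = \<mu>0 * (\<Sum>n=1..N. q n)"
proof -
  have delta: "(\<Sum>n=1..N. of_bool (m = n) :: real) = 1" if "m \<in> {1..N}" for m
  proof -
    have "(\<Sum>n=1..N. of_bool (m = n) :: real) = (\<Sum>n=1..N. if m = n then 1 else 0)"
      by (intro sum.cong) auto
    then show ?thesis using that by simp
  qed
  have zero: "(\<Sum>n=1..N. c * (of_bool (site N k = n) - of_bool (m = n))) = 0"
    if "m \<in> {1..N}" for c :: real and m k
    unfolding sum_distrib_left[symmetric] sum_subtractf
    by (simp only: delta[OF that] delta[OF site_mem[OF assms]] diff_self mult_zero_right)
  have "(\<Sum>n=1..N. \<Sum>m=1..N. \<mu>0 * q m * of_bool (m = n) +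
       \<mu>1 * (q (site N (m + 1)) - q m) * (of_bool (site N (m + 1) = n) - of_bool (m = n))) =
      (\<Sum>m=1..N. \<mu>0 * q m)"
  proof (subst sum.swap, intro sum.cong refl)
    fix m assume m: "m \<in> {1..N}"
    show "(\<Sum>n=1..N. \<mu>0 * q m * of_bool (m = n) +
       \<mu>1 * (q (site N (m + 1)) - q m) * (of_bool (site N (m + 1) = n) - of_bool (m = n))) = \<mu>0 * q m"
      unfolding sum.distrib zero[OF m] unfolding sum_distrib_left[symmetric] delta[OF m] by simp
  qed
  moreover have "(\<Sum>n=1..N. \<Sum>m=1..N. \<Sum>r=1..N div 2. b r * (q (site N (m + r)) - q m) ^ 3 *
       (of_bool (site N (m + r) = n) - of_bool (m = n))) = 0"
  proof -
    define F where "F n m r = b r * (q (site N (m + r)) - q m) ^ 3 *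
       (of_bool (site N (m + r) = n) - of_bool (m = n))" for n m r
    have "(\<Sum>n=1..N. \<Sum>m=1..N. \<Sum>r=1..N div 2. F n m r) =
        (\<Sum>m=1..N. \<Sum>r=1..N div 2. \<Sum>n=1..N. F n m r)"
      by (subst sum.swap) (intro sum.cong refl sum.swap)
    also have "\<dots> = 0"
      unfolding F_def by (rule sum.neutral, rule ballI, rule sum.neutral, rule ballI, rule zero)
    finally show ?thesis unfolding F_def .
  qed
  ultimately show ?thesis
    unfolding force_term_def sum.distrib by (simp add: sum_distrib_left)
qed

text \<open>A Gronwall argument for \<open>x^2 + y^2\<close>, whose rate of change is at most
  \<open>\<bar>1 - k\<bar>\<close> times itself in absolute value. Unlike the energy
  \<open>y^2 + k x^2\<close>, this quantity is definite for either sign of \<open>k\<close>.\<close>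

lemma linear_oscillator_zero:
  fixes x y :: "real \<Rightarrow> real"
  assumes x: "\<And>u. u \<in> {s..t} \<Longrightarrow> (x has_real_derivative y u) (at u within {s..t})"
    and y: "\<And>u. u \<in> {s..t} \<Longrightarrow> (y has_real_derivative - (k * x u)) (at u within {s..t})"
    and zero: "x a = 0" "y a = 0" and a: "a = s \<and> c = t \<or> a = t \<and> c = s" and "s < t"
  shows "x c = 0 \<and> y c = 0"
proof -
  define K where "K = \<bar>1 - k\<bar>"
  define E where "E u = x u ^ 2 + y u ^ 2" for u
  have rate: "\<bar>2 * x u * y u + 2 * y u * - (k * x u)\<bar> \<le> K * E u" for u
  proof -
    have "2 * x u * y u + 2 * y u * - (k * x u) = (1 - k) * (2 * x u * y u)"
      by (simp add: algebra_simps)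
    moreover have "\<bar>2 * x u * y u\<bar> \<le> E u"
      using sum_squares_bound[of "\<bar>x u\<bar>" "\<bar>y u\<bar>"] by (simp add: E_def abs_mult)
    ultimately show ?thesis
      by (simp add: K_def abs_mult mult_left_mono)
  qed
  have E: "(E has_real_derivative 2 * x u * y u + 2 * y u * - (k * x u)) (at u within {s..t})"
    if "u \<in> {s..t}" for u
    unfolding E_def[abs_def]
    by (rule derivative_eq_intros x y that refl | simp)+
  have deriv: "((\<lambda>u. E u * exp (\<sigma> * K * u)) has_real_derivative
      (2 * x u * y u + 2 * y u * - (k * x u) + \<sigma> * K * E u) * exp (\<sigma> * K * u)) (at u within {s..t})"
    if "u \<in> {s..t}" for \<sigma> u
  proof -
    have "((\<lambda>u. exp (\<sigma> * K * u)) has_real_derivative exp (\<sigma> * K * u) * (\<sigma> * K))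
        (at u within {s..t})"
      by (rule derivative_eq_intros refl | simp)+
    from DERIV_mult[OF E[OF that] this] show ?thesis
      by (rule DERIV_cong) (simp only: distrib_left distrib_right mult_ac)
  qed
  \<comment> \<open>The sign \<open>\<sigma> = -1\<close> serves propagation forward from
    \<open>s\<close>, and \<open>\<sigma> = 1\<close> backward from \<open>t\<close>.\<close>
  have mvt: "\<exists>u\<in>{s<..<t}. E t * exp (\<sigma> * K * t) - E s * exp (\<sigma> * K * s) =
      ((2 * x u * y u + 2 * y u * - (k * x u) + \<sigma> * K * E u) * exp (\<sigma> * K * u)) * (t - s)" for \<sigma>
    by (rule mvt_simple[OF \<open>s < t\<close>, of "\<lambda>u. E u * exp (\<sigma> * K * u)"])
       (use deriv in \<open>auto simp: has_field_derivative_def\<close>)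
  have "E c \<le> 0"
    using a
  proof
    assume a: "a = s \<and> c = t"
    obtain u where u: "E t * exp (-1 * K * t) - E s * exp (-1 * K * s) =
      ((2 * x u * y u + 2 * y u * - (k * x u) + -1 * K * E u) * exp (-1 * K * u)) * (t - s)"
      using mvt[of "-1"] by blast
    have "\<dots> \<le> 0"
      using rate[of u] \<open>s < t\<close> by (intro mult_nonpos_nonneg) auto
    moreover have "E s = 0" using a zero by (simp add: E_def)
    ultimately have "E t * exp (-1 * K * t) \<le> 0" using u by simp
    then show ?thesis using a by (simp add: mult_le_0_iff)
  next
    assume a: "a = t \<and> c = s"
    obtain u where u: "E t * exp (1 * K * t) - E s * exp (1 * K * s) =
      ((2 * x u * y u + 2 * y u * - (k * x u) + 1 * K * E u) * exp (1 * K * u)) * (t - s)"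
      using mvt[of 1] by blast
    have "\<dots> \<ge> 0"
      using rate[of u] \<open>s < t\<close> by (intro mult_nonneg_nonneg) auto
    moreover have "E t = 0" using a zero by (simp add: E_def)
    ultimately have "E s * exp (1 * K * s) \<le> 0" using u by simp
    then show ?thesis using a by (simp add: mult_le_0_iff)
  qed
  then show ?thesis
    unfolding E_def by (simp add: sum_power2_le_zero_iff)
qed

text \<open>The total position \<open>X\<close> and total momentum \<open>Y\<close> obey the closed
  linear system \<open>X' = Y\<close>, \<open>Y' = - \<mu>0 X\<close>, so zero data at one time
  persist.\<close>

lemma zero_mean_invariant_quartic_hamiltonian:
  assumes "N > 0"
  shows "zero_mean_invariant N (quartic_hamiltonian N \<mu>0 \<mu>1 b)"
  unfolding zero_mean_invariant_def
proof (intro allI impI ballI)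
  fix T :: "real set" and q p s t
  assume T: "is_interval T" and st: "s \<in> T" "t \<in> T"
    and sol: "hamilton_solution N (quartic_hamiltonian N \<mu>0 \<mu>1 b) T q p"
    and zero: "zero_mean N (q s) (p s)"
  define X Y where "X u = (\<Sum>n=1..N. q u n)" and "Y u = (\<Sum>n=1..N. p u n)" for u
  have q: "((\<lambda>u. q u n) has_real_derivative p u n) (at u within T)"
    and p: "((\<lambda>u. p u n) has_real_derivative - force_term N \<mu>0 \<mu>1 b (q u) n) (at u within T)"
    if "u \<in> T" "n \<in> {1..N}" for u n
    using sol that unfolding hamilton_solution_def
    by (metis deriv_quartic_hamiltonian_momentum, metis deriv_quartic_hamiltonian_position)
  have X: "(X has_real_derivative Y u) (at u within T)" if "u \<in> T" for u
    unfolding X_def[abs_def] Y_def using q that by (intro DERIV_sum) blast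
  have Y: "(Y has_real_derivative - (\<mu>0 * X u)) (at u within T)" if "u \<in> T" for u
  proof -
    have "(Y has_real_derivative (\<Sum>n=1..N. - force_term N \<mu>0 \<mu>1 b (q u) n)) (at u within T)"
      unfolding Y_def[abs_def] using p that by (intro DERIV_sum) blast
    then show ?thesis
      unfolding sum_negf sum_force_term[OF assms] X_def .
  qed
  have zero: "X s = 0" "Y s = 0"
    using zero by (simp_all add: zero_mean_def X_def Y_def)
  have "X t = 0 \<and> Y t = 0"
  proof (cases "s = t")
    case False
    \<comment> \<open>The time \<open>t\<close> may lie before \<open>s\<close>, hence the interval
      from the minimum to the maximum.\<close>
    let ?I = "{min s t..max s t}"
    have I: "?I \<subseteq> T"
    proof
      fix u assume "u \<in> ?I"
      then show "u \<in> T"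
        using mem_is_interval_1_I[OF T, of s t u] mem_is_interval_1_I[OF T, of t s u] st
        by (cases "s \<le> t") auto
    qed
    show ?thesis
    proof (rule linear_oscillator_zero[of "min s t" "max s t" X Y \<mu>0 s])
      fix u assume u: "u \<in> ?I"
      then have "u \<in> T" using I by blast
      show "(X has_real_derivative Y u) (at u within ?I)"
        by (rule has_field_derivative_subset[OF X[OF \<open>u \<in> T\<close>] I])
      show "(Y has_real_derivative - (\<mu>0 * X u)) (at u within ?I)"
        by (rule has_field_derivative_subset[OF Y[OF \<open>u \<in> T\<close>] I])
    qed (use zero False in auto)
  qed (use zero in auto)
  then show "zero_mean N (q t) (p t)"
    by (simp add: zero_mean_def X_def Y_def)
qed

theorem theorem7:
  fixes N :: nat and \<mu>0 \<mu>1 :: real and b :: "nat \<Rightarrow> real"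
  assumes "N > 0" and "4 dvd N"
    and "nontrivial_solution N b"
  shows "symmetric_lattice N (quartic_hamiltonian N \<mu>0 \<mu>1 b) \<and>
    (\<forall>q p. quartic_hamiltonian N \<mu>0 \<mu>1 b q p =
       1/2 * (\<Sum>n=1..N. (p n)\<^sup>2) +
       1/2 * (\<Sum>n=1..N. \<mu>0 * (q n)\<^sup>2 + \<mu>1 * (periodic N q (n+1) - q n)\<^sup>2) +
       1/4 * (\<Sum>n=1..N. \<Sum>r=1..N div 2 - 1.
                b 1 * (sin (pi / real N))\<^sup>2 / (sin (real r * pi / real N))\<^sup>2 *
                (periodic N q (n+r) - q n) ^ 4) +
       1/8 * (\<Sum>n=1..N. b 1 * (sin (pi / real N))\<^sup>2 * (periodic N q (n + N div 2) - q n) ^ 4)) \<and>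
    b 1 \<noteq> 0 \<and>
    (\<forall>c. c \<noteq> 0 \<longrightarrow> (\<exists>b'. nontrivial_solution N b' \<and> b' 1 = c))"
proof (intro conjI allI impI)
  have "even N" using assms(2) by (rule dvd_trans[rotated]) simp
  define M where "M = N div 2"
  have M: "N = 2 * M" "M > 0"
    using \<open>even N\<close> assms(1) by (auto simp: M_def)
  define C where "C = b 1 * (sin (pi / real N))\<^sup>2"
  have bal: "balanced_couplings N b C"
    unfolding C_def by (rule nontrivial_solution_balanced[OF assms])
  show "symmetric_lattice N (quartic_hamiltonian N \<mu>0 \<mu>1 b)"
    unfolding symmetric_lattice_def
    using assms(1) \<open>even N\<close> mvars_potential_poly[OF assms(1)] quartic_hamiltonian_natural
      zero_mean_invariant_quartic_hamiltonian[OF assms(1)]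
      asymmetric_potential_eq_0[OF assms(1) \<open>even N\<close> bal]
    by blast
  show "b 1 \<noteq> 0"
    by (rule nontrivial_solution_first_nonzero[OF assms])
  show "\<exists>b'. nontrivial_solution N b' \<and> b' 1 = c" if "c \<noteq> 0" for c
    by (rule exists_nontrivial_solution[OF assms(1,2) that])
  fix q p :: "nat \<Rightarrow> real"
  \<comment> \<open>The antipodal distance is set apart: its coupling is \<open>C / 2\<close>, which
    turns the prefactor 1/4 into 1/8.\<close>
  have set: "{1..M} = insert M {1..M - 1}" using M by auto
  have couplings: "(\<Sum>r=1..M. b r * (periodic N q (n + r) - q n) ^ 4) =
      (\<Sum>r=1..M - 1. C / (sin (real r * pi / real N))\<^sup>2 * (periodic N q (n + r) - q n) ^ 4) +
      1 / 2 * (C * (periodic N q (n + M) - q n) ^ 4)" for n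
  proof -
    have "(\<Sum>r=1..M - 1. b r * (periodic N q (n + r) - q n) ^ 4) =
        (\<Sum>r=1..M - 1. C / (sin (real r * pi / real N))\<^sup>2 * (periodic N q (n + r) - q n) ^ 4)"
    proof (intro sum.cong refl)
      fix r assume "r \<in> {1..M - 1}"
      then have "r \<in> {1..<M}" by auto
      from balanced_couplings_values(1)[OF M bal this]
      show "b r * (periodic N q (n + r) - q n) ^ 4 =
          C / (sin (real r * pi / real N))\<^sup>2 * (periodic N q (n + r) - q n) ^ 4" by simp
    qed
    then show ?thesis
      unfolding set using balanced_couplings_values(2)[OF M bal] M(2) by simp
  qed
  have half: "(\<Sum>n=1..N. 1 / 2 * (p n)\<^sup>2) = 1 / 2 * (\<Sum>n=1..N. (p n)\<^sup>2)"
    "(\<Sum>n=1..N. \<mu>0 / 2 * (q n)\<^sup>2 + \<mu>1 / 2 * (periodic N q (n + 1) - q n)\<^sup>2) =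
      1 / 2 * (\<Sum>n=1..N. \<mu>0 * (q n)\<^sup>2 + \<mu>1 * (periodic N q (n + 1) - q n)\<^sup>2)"
    unfolding sum_distrib_left by (intro sum.cong refl; simp add: algebra_simps)+
  have split: "(\<Sum>n=1..N. f n + 1 / 2 * g n) = sum f {1..N} + 1 / 2 * sum g {1..N}"
    for f g :: "nat \<Rightarrow> real"
    by (simp add: sum.distrib sum_distrib_left)
  show "quartic_hamiltonian N \<mu>0 \<mu>1 b q p =
       1/2 * (\<Sum>n=1..N. (p n)\<^sup>2) +
       1/2 * (\<Sum>n=1..N. \<mu>0 * (q n)\<^sup>2 + \<mu>1 * (periodic N q (n+1) - q n)\<^sup>2) +
       1/4 * (\<Sum>n=1..N. \<Sum>r=1..N div 2 - 1.
                b 1 * (sin (pi / real N))\<^sup>2 / (sin (real r * pi / real N))\<^sup>2 *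
                (periodic N q (n+r) - q n) ^ 4) +
       1/8 * (\<Sum>n=1..N. b 1 * (sin (pi / real N))\<^sup>2 * (periodic N q (n + N div 2) - q n) ^ 4)"
    unfolding quartic_hamiltonian_def M_def[symmetric] C_def[symmetric] couplings half split
    by (simp add: distrib_left add_divide_distrib)
qed

end
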